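(* Let $1\leq m\leq n-1$ be integers. Every Radon measure $\mu$ on $\mathbb{R}^n$ decomposes uniquely as $\mu=\mu_G+\mu_G^\perp$, where $\mu_G$ is a Radon measure carried by $m$-dimensional Lipschitz graphs and $\mu_G^\perp$ is a Radon measure singular to $m$-dimensional Lipschitz graphs. The component measures are identified by $$\mu_G=\mu\llcorner\{x\in\mathbb{R}^n:G_{\mu,X}(x)<\infty \text{ for some bad cone }X\},$$ $$\mu_G^\perp=\mu\llcorner\{x\in\mathbb{R}^n:G_{\mu,X}(x)=\infty \text{ for every bad cone }X\}.$$ That is, there exists a sequence $\Gamma_1,\Gamma_2,\dots$ of $m$-dimensional Lipschitz graphs such that $\mu_G(\mathbb{R}^n\setminus\bigcup_{i=1}^\infty\Gamma_i)=0$, and $\mu_G^\perp(\Gamma)=0$ for every $m$-dimensional Lipschitz graph $\Gamma$.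
   Context: Fix integers $1\le m\le n-1$. $G(n,m)$ is the set of $m$-dimensional linear subspaces of $\mathbb{R}^n$ and $V^\perp$ is the orthogonal complement of $V$. $B(x,r)$ and $U(x,r)$ denote closed and open Euclidean balls; $\operatorname{diam}$ is diameter. Measures. A Radon measure on $\mathbb{R}^n$ is a Borel regular outer measure that is finite on compact sets. The restriction of $\mu$ to $E$ is $\mu\llcorner E(A)=\mu(E\cap A)$ for all $A\subseteq\mathbb{R}^n$. For a nonempty family $\mathcal{F}$ of Borel sets, $\mu$ is carried by $\mathcal{F}$ if there exist $F_1,F_2,\dots\in\mathcal{F}$ with $\mu(\mathbb{R}^n\setminus\bigcup_{i=1}^\infty F_i)=0$, and $\mu$ is singular to $\mathcal{F}$ if $\mu(F)=0$ for every $F\in\mathcal{F}$. Lipschitz graphs. An $m$-dimensional Lipschitz graph is a set $\mathrm{Graph}(f)=\{(x,f(x)):x\in V\}=\{x+f(x):x\in V\}\subseteq V\times V^\perp=\mathbb{R}^n$, where $V\in G(n,m)$ and $f:V\to V^\perp$ is a Lipschitz function. Bad cones. A bad cone is a set $X=X(V,\alpha)=\{x\in\mathbb{R}^n:\operatorname{dist}(x,V)>\alpha\operatorname{dist}(x,V^\perp)\}$ with $V\in G(n,m)$ and $\alpha\in(0,\infty)$. Write $X_x=x+X$ and $X_Q=\bigcup_{x\in Q}X_x$ for nonempty $Q\subseteq\mathbb{R}^n$. Dyadic cubes. A dyadic cube is a half-open cube $Q=\prod_{i=1}^n[j_i2^{-k},(j_i+1)2^{-k})$ with $k,j_1,\dots,j_n\in\mathbb{Z}$;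 $\operatorname{side}Q=2^{-k}$ and $x_Q$ is the center of $Q$. Conical defect. For a dyadic cube $Q$ and bad cone $X=X(V,\alpha)$, put $r_{Q,X}=81\sqrt{n}\max(\alpha,1/\alpha)\operatorname{side}Q$ and $A_{Q,X}=X_Q\cap B(x_Q,r_{Q,X})\setminus U(x_Q,r_{Q,X}/3)$. Let $\Delta^*_{Q,X}$ be the set of all dyadic cubes $R$ with $\operatorname{side}R=\operatorname{side}Q$ and $R\cap A_{Q,X}\ne\emptyset$. For a Radon measure $\mu$, set $\mathrm{Defect}(\mu,Q,X)=\sum_{R\in\Delta^*_{Q,X}}\mu(R)/\mu(Q)$ if $\mu(Q)>0$, and $\mathrm{Defect}(\mu,Q,X)=0$ if $\mu(Q)=0$. Conical Dini function. $G_{\mu,X}:\mathbb{R}^n\to[0,\infty]$ is $G_{\mu,X}(x)=\sum_{\operatorname{side}Q\le1}\mathrm{Defect}(\mu,Q,X)\,\chi_Q(x)$, the sum over all dyadic cubes $Q$ of side length at most $1$. *)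

theory Defs
  imports "HOL-Analysis.Analysis"
begin

section \<open>Radon measures\<close>

text \<open>Measures are outer measures, defined on all subsets of the space.\<close>

definition radon_measure :: "('a::euclidean_space set \<Rightarrow> ennreal) \<Rightarrow> bool" where
  "radon_measure \<mu> \<longleftrightarrow>
     outer_measure_space UNIV \<mu> \<and>
     sets borel \<subseteq> lambda_system UNIV UNIV \<mu> \<and>
     (\<forall>A. \<exists>B \<in> sets borel. A \<subseteq> B \<and> \<mu> B = \<mu> A) \<and>
     (\<forall>K. compact K \<longrightarrow> \<mu> K < \<infinity>)"

definition restrict_outer :: "('a set \<Rightarrow> ennreal) \<Rightarrow> 'a set \<Rightarrow> 'a set \<Rightarrow> ennreal" where
  "restrict_outer \<mu> E A = \<mu> (E \<inter> A)"

definition carried_by :: "('a set \<Rightarrow> ennreal) \<Rightarrow> 'a set set \<Rightarrow> bool" where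
  "carried_by \<mu> \<F> \<longleftrightarrow> (\<exists>F::nat \<Rightarrow> 'a set. (\<forall>i. F i \<in> \<F>) \<and> \<mu> (UNIV - (\<Union>i. F i)) = 0)"

definition singular_to :: "('a set \<Rightarrow> ennreal) \<Rightarrow> 'a set set \<Rightarrow> bool" where
  "singular_to \<mu> \<F> \<longleftrightarrow> (\<forall>F \<in> \<F>. \<mu> F = 0)"


section \<open>Lipschitz graphs and bad cones\<close>

definition grassmannian :: "nat \<Rightarrow> 'a::euclidean_space set set" where
  "grassmannian m = {V. subspace V \<and> dim V = m}"

definition lipschitz_graphs :: "nat \<Rightarrow> 'a::euclidean_space set set" where
  "lipschitz_graphs m =
     {{x + f x | x. x \<in> V} | V f. V \<in> grassmannian m \<and> f ` V \<subseteq> V\<^sup>\<bottom> \<and> (\<exists>L. L-lipschitz_on V f)}"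

definition bad_cone :: "'a::euclidean_space set \<Rightarrow> real \<Rightarrow> 'a set" where
  "bad_cone V \<alpha> = {x. infdist x V > \<alpha> * infdist x (V\<^sup>\<bottom>)}"

text \<open>\<open>cone_at X Q\<close> is the union of the translates \<open>x + X\<close> over \<open>x \<in> Q\<close>.\<close>

definition cone_at :: "'a::euclidean_space set \<Rightarrow> 'a set \<Rightarrow> 'a set" where
  "cone_at X Q = (\<Union>x\<in>Q. (+) x ` X)"


section \<open>Dyadic cubes\<close>

definition dyadic_cube :: "int \<Rightarrow> ('n \<Rightarrow> int) \<Rightarrow> (real ^ 'n::finite) set" where
  "dyadic_cube k j =
     {x. \<forall>i. of_int (j i) * 2 powi (-k) \<le> x $ i \<and> x $ i < (of_int (j i) + 1) * 2 powi (-k)}"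

definition dyadic_cubes :: "(real ^ 'n::finite) set set" where
  "dyadic_cubes = {dyadic_cube k j | k j. True}"

text \<open>Side length and center are functions of the cube as a point set; they are well defined
  by \<open>cube_side_dyadic_cube\<close> and \<open>cube_center_dyadic_cube\<close> below.\<close>

definition cube_side :: "(real ^ 'n::finite) set \<Rightarrow> real" where
  "cube_side Q = (THE s. \<exists>k j. Q = dyadic_cube k j \<and> s = 2 powi (-k))"

definition cube_center :: "(real ^ 'n::finite) set \<Rightarrow> real ^ 'n" where
  "cube_center Q =
     (THE c. \<exists>k j. Q = dyadic_cube k j \<and> c = (\<chi> i. (of_int (j i) + 1/2) * 2 powi (-k)))"

lemma dyadic_cube_subset_imp:
  fixes j j' :: "'n::finite \<Rightarrow> int"
  assumes "dyadic_cube k j \<subseteq> dyadic_cube k' j'"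
  shows "of_int (j' i) * 2 powi (-k') \<le> (of_int (j i) * 2 powi (-k) :: real)"
    and "(of_int (j i) + 1) * 2 powi (-k) \<le> ((of_int (j' i) + 1) * 2 powi (-k') :: real)"
proof -
  define p where "p = (\<lambda>t. (\<chi> i. (of_int (j i) + t) * 2 powi (-k)) :: real ^ 'n)"
  have p: "p t \<in> dyadic_cube k j" if "0 \<le> t" "t < 1" for t
    using that by (auto simp: p_def dyadic_cube_def mult_right_mono)
  have p': "p t \<in> dyadic_cube k' j'" if "0 \<le> t" "t < 1" for t
    using p[OF that] assms by blast
  show "of_int (j' i) * 2 powi (-k') \<le> (of_int (j i) * 2 powi (-k) :: real)"
    using p'[of 0] by (auto simp: p_def dyadic_cube_def)
  have less: "(of_int (j i) + t) * 2 powi (-k) \<le> ((of_int (j' i) + 1) * 2 powi (-k') :: real)"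
    if "0 < t" "t < 1" for t
    using p'[of t] that by (auto simp: p_def dyadic_cube_def intro: less_imp_le)
  have lim: "((\<lambda>t. (of_int (j i) + t) * 2 powi (-k)) \<longlongrightarrow> (of_int (j i) + 1) * 2 powi (-k)) (at_left (1::real))"
    by (intro tendsto_intros)
  have ev: "\<forall>\<^sub>F t in at_left (1::real). (of_int (j i) + t) * 2 powi (-k) \<le> (of_int (j' i) + 1) * 2 powi (-k')"
    unfolding eventually_at_left[OF zero_less_one] using less by (intro exI[of _ 0]) auto
  show "(of_int (j i) + 1) * 2 powi (-k) \<le> ((of_int (j' i) + 1) * 2 powi (-k') :: real)"
    by (rule tendsto_upperbound[OF lim ev]) simp
qed

lemma dyadic_cube_eq_iff:
  fixes j j' :: "'n::finite \<Rightarrow> int"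
  shows "dyadic_cube k j = dyadic_cube k' j' \<longleftrightarrow> k = k' \<and> j = j'"
proof
  assume eq: "dyadic_cube k j = dyadic_cube k' j'"
  have a: "of_int (j i) * 2 powi (-k) = (of_int (j' i) * 2 powi (-k') :: real)" for i
    using dyadic_cube_subset_imp(1)[of k j k' j' i] dyadic_cube_subset_imp(1)[of k' j' k j i] eq
    by auto
  have b: "(of_int (j i) + 1) * 2 powi (-k) = ((of_int (j' i) + 1) * 2 powi (-k') :: real)" for i
    using dyadic_cube_subset_imp(2)[of k j k' j' i] dyadic_cube_subset_imp(2)[of k' j' k j i] eq
    by auto
  have c: "(2::real) powi (-k) = 2 powi (-k')"
    using a b by (simp add: algebra_simps)
  have k: "k = k'"
  proof (rule ccontr)
    assume "k \<noteq> k'"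
    then consider "-k < -k'" | "-k' < -k" by linarith
    then show False
      using c power_int_strict_increasing[of "-k" "-k'" "2::real"]
        power_int_strict_increasing[of "-k'" "-k" "2::real"] by cases auto
  qed
  moreover have "j = j'"
    using a k by (intro ext) simp
  ultimately show "k = k' \<and> j = j'" ..
qed auto

lemma cube_side_dyadic_cube [simp]: "cube_side (dyadic_cube k j) = 2 powi (-k)"
  unfolding cube_side_def by (rule the_equality) (auto simp: dyadic_cube_eq_iff)

lemma cube_center_dyadic_cube [simp]:
  "cube_center (dyadic_cube k j) = (\<chi> i. (of_int (j i) + 1/2) * 2 powi (-k))"
  unfolding cube_center_def by (rule the_equality) (auto simp: dyadic_cube_eq_iff)


section \<open>Conical defect and conical Dini function\<close>

text \<open>A bad cone is given by its parameters: \<open>V\<close> and \<open>\<alpha>\<close> stand for the cone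
  \<open>bad_cone V \<alpha>\<close>, whose radius depends on \<open>\<alpha>\<close>.\<close>

definition cone_radius :: "(real ^ 'n::finite) set \<Rightarrow> real \<Rightarrow> real" where
  "cone_radius Q \<alpha> = 81 * sqrt (real CARD('n)) * max \<alpha> (1 / \<alpha>) * cube_side Q"

definition cone_annulus :: "(real ^ 'n::finite) set \<Rightarrow> (real ^ 'n) set \<Rightarrow> real \<Rightarrow> (real ^ 'n) set" where
  "cone_annulus Q V \<alpha> =
     cone_at (bad_cone V \<alpha>) Q \<inter> cball (cube_center Q) (cone_radius Q \<alpha>)
       - ball (cube_center Q) (cone_radius Q \<alpha> / 3)"

definition cone_cubes :: "(real ^ 'n::finite) set \<Rightarrow> (real ^ 'n) set \<Rightarrow> real \<Rightarrow> (real ^ 'n) set set" where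
  "cone_cubes Q V \<alpha> =
     {R \<in> dyadic_cubes. cube_side R = cube_side Q \<and> R \<inter> cone_annulus Q V \<alpha> \<noteq> {}}"

lemma finite_cone_cubes:
  fixes V :: "(real ^ 'n::finite) set"
  assumes "Q \<in> dyadic_cubes"
  shows "finite (cone_cubes Q V \<alpha>)"
proof -
  obtain k and j :: "'n \<Rightarrow> int" where Q: "Q = dyadic_cube k j"
    using assms by (auto simp: dyadic_cubes_def)
  define s :: real where "s = 2 powi (-k)"
  have s: "s > 0" by (simp add: s_def)
  have "bounded (cone_annulus Q V \<alpha>)"
    unfolding cone_annulus_def by (rule bounded_subset[OF bounded_cball]) auto
  then obtain M where M: "\<And>x. x \<in> cone_annulus Q V \<alpha> \<Longrightarrow> norm x \<le> M"
    by (auto simp: bounded_iff)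
  define S where "S = {\<lfloor>- M / s\<rfloor> - 1 .. \<lceil>M / s\<rceil>}"
  have "cone_cubes Q V \<alpha> \<subseteq> dyadic_cube k ` (PiE UNIV (\<lambda>_. S))"
  proof
    fix R assume R: "R \<in> cone_cubes Q V \<alpha>"
    then obtain k' j' where R': "R = dyadic_cube k' j'"
      by (auto simp: cone_cubes_def dyadic_cubes_def)
    have pw: "(2::real) powi (-k') = 2 powi (-k)"
      using R by (simp add: cone_cubes_def Q R')
    have k': "k' = k"
    proof (rule ccontr)
      assume "k' \<noteq> k"
      then consider "-k < -k'" | "-k' < -k" by linarith
      then show False
        using pw power_int_strict_increasing[of "-k" "-k'" "2::real"]
          power_int_strict_increasing[of "-k'" "-k" "2::real"] by cases auto
    qed
    obtain x where x: "x \<in> R" "x \<in> cone_annulus Q V \<alpha>"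
      using R by (auto simp: cone_cubes_def)
    have "j' i \<in> S" for i
    proof -
      have "\<bar>x $ i\<bar> \<le> M"
        using M[OF x(2)] component_le_norm_cart[of x i] by linarith
      moreover have "of_int (j' i) * s \<le> x $ i" "x $ i < (of_int (j' i) + 1) * s"
        using x(1) by (auto simp: R' k' dyadic_cube_def s_def)
      ultimately have "of_int (j' i) * s \<le> M" "- M < (of_int (j' i) + 1) * s"
        by linarith+
      then have "of_int (j' i) \<le> M / s" "- M / s < of_int (j' i) + 1"
        by (simp_all only: pos_le_divide_eq[OF s] pos_divide_less_eq[OF s])
      then show ?thesis
        unfolding S_def atLeastAtMost_iff by linarith
    qed
    then show "R \<in> dyadic_cube k ` (PiE UNIV (\<lambda>_. S))"
      by (auto simp: R' k')
  qed
  moreover have "finite (PiE (UNIV :: 'n set) (\<lambda>_. S))"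
    by (intro finite_PiE) (auto simp: S_def)
  ultimately show ?thesis
    by (meson finite_imageI finite_subset)
qed

definition defect ::
  "((real ^ 'n::finite) set \<Rightarrow> ennreal) \<Rightarrow> (real ^ 'n) set \<Rightarrow> (real ^ 'n) set \<Rightarrow> real \<Rightarrow> ennreal" where
  "defect \<mu> Q V \<alpha> = (if \<mu> Q > 0 then (\<Sum>R\<in>cone_cubes Q V \<alpha>. \<mu> R / \<mu> Q) else 0)"

definition conical_dini ::
  "((real ^ 'n::finite) set \<Rightarrow> ennreal) \<Rightarrow> (real ^ 'n) set \<Rightarrow> real \<Rightarrow> real ^ 'n \<Rightarrow> ennreal" where
  "conical_dini \<mu> V \<alpha> x =
     (\<Sum>\<^sub>\<infinity>Q\<in>{Q \<in> dyadic_cubes. cube_side Q \<le> 1}. defect \<mu> Q V \<alpha> * indicator Q x)"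


section \<open>The decomposition\<close>

definition lipschitz_graph_decomposition ::
  "nat \<Rightarrow> ('a::euclidean_space set \<Rightarrow> ennreal) \<Rightarrow> ('a set \<Rightarrow> ennreal) \<Rightarrow> ('a set \<Rightarrow> ennreal) \<Rightarrow> bool" where
  "lipschitz_graph_decomposition m \<mu> \<nu> \<sigma> \<longleftrightarrow>
     (\<forall>A. \<mu> A = \<nu> A + \<sigma> A) \<and>
     radon_measure \<nu> \<and> carried_by \<nu> (lipschitz_graphs m) \<and>
     radon_measure \<sigma> \<and> singular_to \<sigma> (lipschitz_graphs m)"

end

theory Submission
  imports Defs
begin

text \<open>
  Let \<open>E\<close> be the set of points at which some conical Dini function of \<open>\<mu>\<close> is finite. Everything
  follows once \<open>E\<close> is known to contain almost every point of each Lipschitz graph and to coincide, up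
  to a \<open>\<mu>\<close>-null set, with a countable union \<open>S\<close> of such graphs. Graphs are closed, so \<open>S\<close> is Borel, and
  restricting \<open>\<mu>\<close> to \<open>E\<close> and to its complement gives Radon measures although \<open>E\<close> is an uncountable
  union over all bad cones. Two estimates, dual to each other, make up the proof.

  \<^item> Graphs lie in \<open>E\<close> almost everywhere (\<open>graph_minus_finite_dini_null\<close>). Let \<open>\<Gamma>\<close> be the graph of
  an \<open>L\<close>-Lipschitz function over \<open>V\<close> and take \<open>\<alpha> = 2(L+1)\<close>. If a cube \<open>Q\<close> meets \<open>\<Gamma>\<close>,
  then every point of every cube in its conical annulus has distance comparable to \<open>side Q\<close> both
  from \<open>Q\<close> and from \<open>\<Gamma>\<close>. Hence a given point is counted for boundedly many \<open>Q\<close>, and the integral of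
  the Dini function over a bounded part of \<open>\<Gamma>\<close> is at most a multiple of the \<open>\<mu>\<close>-measure of a ball.

  \<^item> \<open>E\<close> is covered by countably many graphs up to a null set (\<open>finite_dini_graph_coverable\<close>). Suppose
  that the Dini function is bounded on \<open>A\<close>. Up to a set of small measure, all cubes around a point of
  \<open>A\<close> carry a fixed proportion of \<open>A\<close>, and over such cubes the masses of the annuli have a
  finite sum. By Borel--Cantelli almost every point of \<open>A\<close> eventually avoids these annuli. Two points
  that are close together and in bad position relative to each other lie in each other's annulus at the scale of
  their distance. So the points that avoid all annuli beyond a fixed scale satisfy
  locally a cone condition, that is, they lie on Lipschitz graphs (\<open>subset_lipschitz_graph\<close>).

  The second estimate holds for each single cone, and an uncountable union of null sets need not be
  null. The way out is that the argument works equally well with a narrower cone and a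
  thinner annulus. Countably many narrower cones and thinner annuli suffice to have one inside
  any given pair, and these give smaller Dini functions (\<open>inner_dini_le_conical_dini\<close>).
\<close>

section \<open>Radon outer measures\<close>

lemma radon_empty: "radon_measure \<mu> \<Longrightarrow> \<mu> {} = 0"
  by (simp add: radon_measure_def outer_measure_space_def positive_def)

lemma radon_mono: "radon_measure \<mu> \<Longrightarrow> A \<subseteq> B \<Longrightarrow> \<mu> A \<le> \<mu> B"
  by (simp add: radon_measure_def outer_measure_space_def increasing_def)

lemma radon_null_mono: "radon_measure \<mu> \<Longrightarrow> A \<subseteq> B \<Longrightarrow> \<mu> B = 0 \<Longrightarrow> \<mu> A = 0"
  using radon_mono[of \<mu> A B] by simp

lemma radon_null_UN:
  fixes A :: "nat \<Rightarrow> _ set"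
  assumes \<mu>: "radon_measure \<mu>" and null: "\<And>i. \<mu> (A i) = 0"
  shows "\<mu> (\<Union>i. A i) = 0"
proof -
  have "\<mu> (\<Union>i. disjointed A i) \<le> (\<Sum>i. \<mu> (disjointed A i))"
    using \<mu> unfolding radon_measure_def outer_measure_space_def countably_subadditive_def
    by (simp add: disjoint_family_disjointed)
  moreover have "\<mu> (disjointed A i) = 0" for i
    using radon_null_mono[OF \<mu> disjointed_subset null] .
  ultimately show ?thesis
    by (simp add: UN_disjointed_eq)
qed

lemma radon_null_UN_countable:
  assumes \<mu>: "radon_measure \<mu>" and I: "countable I" and null: "\<And>i. i \<in> I \<Longrightarrow> \<mu> (A i) = 0"
  shows "\<mu> (\<Union>i\<in>I. A i) = 0"
proof (cases "I = {}")
  case True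
  then show ?thesis by (simp add: radon_empty[OF \<mu>])
next
  case False
  have "\<mu> (\<Union>n. A (from_nat_into I n)) = 0"
    by (rule radon_null_UN[OF \<mu>]) (auto intro: null from_nat_into[OF False])
  moreover have "(\<Union>n. A (from_nat_into I n)) = (\<Union>i\<in>I. A i)"
    using range_from_nat_into[OF False I] by (metis image_image)
  ultimately show ?thesis by simp
qed

lemma radon_split:
  assumes "radon_measure \<mu>" "S \<in> sets borel"
  shows "\<mu> A = \<mu> (A \<inter> S) + \<mu> (A - S)"
proof -
  have "S \<in> lambda_system UNIV UNIV \<mu>"
    using assms by (auto simp: radon_measure_def)
  then have "\<mu> (S \<inter> A) + \<mu> ((UNIV - S) \<inter> A) = \<mu> A"
    by (simp add: lambda_system_def)
  moreover have "(UNIV - S) \<inter> A = A - S" by auto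
  ultimately show ?thesis by (simp add: Int_commute)
qed

lemma radon_subadditive:
  assumes \<mu>: "radon_measure \<mu>" and A: "A \<in> sets borel"
  shows "\<mu> (A \<union> B) \<le> \<mu> A + \<mu> B"
proof -
  have "\<mu> ((A \<union> B) \<inter> A) \<le> \<mu> A" "\<mu> ((A \<union> B) - A) \<le> \<mu> B"
    by (rule radon_mono[OF \<mu>]; blast)+
  then show ?thesis
    unfolding radon_split[OF \<mu> A, of "A \<union> B"] by (rule add_mono)
qed

text \<open>
  The sets may fail to be measurable, so subadditivity is applied to a Borel null set that contains
  the difference; Borel regularity provides it.
\<close>

lemma radon_eq_mod_null:
  assumes \<mu>: "radon_measure \<mu>" and "\<mu> (A - B) = 0" "\<mu> (B - A) = 0"
  shows "\<mu> A = \<mu> B"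
proof -
  have le: "\<mu> X \<le> \<mu> Y" if null: "\<mu> (X - Y) = 0" for X Y
  proof -
    obtain N where N: "N \<in> sets borel" "X - Y \<subseteq> N" "\<mu> N = 0"
      using \<mu> null unfolding radon_measure_def by metis
    have "\<mu> X \<le> \<mu> (N \<union> Y)"
      using N by (intro radon_mono[OF \<mu>]) auto
    also have "\<dots> \<le> \<mu> N + \<mu> Y"
      by (rule radon_subadditive[OF \<mu> N(1)])
    finally show ?thesis using N by simp
  qed
  show ?thesis by (intro antisym le assms)
qed

lemma restrict_outer_eq_mod_null:
  assumes \<mu>: "radon_measure \<mu>" and null: "\<mu> (E - S) = 0" "\<mu> (S - E) = 0"
  shows "restrict_outer \<mu> E = restrict_outer \<mu> S"
proof
  fix A
  show "restrict_outer \<mu> E A = restrict_outer \<mu> S A"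
    unfolding restrict_outer_def
    by (rule radon_eq_mod_null[OF \<mu>]; rule radon_null_mono[OF \<mu> _ null(1)] radon_null_mono[OF \<mu> _ null(2)])
       auto
qed

text \<open>
  Only Borel regularity needs an argument: to a Borel hull of \<open>S \<inter> A\<close> one adds the complement of \<open>S\<close>,
  which the restricted measure does not see.
\<close>

lemma radon_restrict_outer:
  assumes \<mu>: "radon_measure \<mu>" and S: "S \<in> sets borel"
  shows "radon_measure (restrict_outer \<mu> S)"
  unfolding radon_measure_def
proof (intro conjI allI impI ballI subsetI)
  show "outer_measure_space UNIV (restrict_outer \<mu> S)"
  proof -
    have "positive UNIV (restrict_outer \<mu> S)"
      using radon_empty[OF \<mu>] by (simp add: positive_def restrict_outer_def)
    moreover have "increasing UNIV (restrict_outer \<mu> S)"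
      by (auto simp: increasing_def restrict_outer_def intro!: radon_mono[OF \<mu>])
    moreover have "countably_subadditive UNIV (restrict_outer \<mu> S)"
      unfolding countably_subadditive_def
    proof (intro allI impI)
      fix A :: "nat \<Rightarrow> 'a set" assume d: "disjoint_family A"
      have cs: "countably_subadditive UNIV \<mu>"
        using \<mu> by (simp add: radon_measure_def outer_measure_space_def)
      have "\<mu> (\<Union>i. S \<inter> A i) \<le> (\<Sum>i. \<mu> (S \<inter> A i))"
        using cs[unfolded countably_subadditive_def, rule_format, of "\<lambda>i. S \<inter> A i"] d
        by (auto simp: disjoint_family_on_def)
      then show "restrict_outer \<mu> S (\<Union>i. A i) \<le> (\<Sum>i. restrict_outer \<mu> S (A i))"
        by (simp add: restrict_outer_def)
    qed
    ultimately show ?thesis by (simp add: outer_measure_space_def)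
  qed
next
  fix B :: "'a set" assume B: "B \<in> sets borel"
  show "B \<in> lambda_system UNIV UNIV (restrict_outer \<mu> S)"
    using radon_split[OF \<mu> B, of "S \<inter> _", symmetric]
    by (auto simp: lambda_system_def restrict_outer_def Int_ac Diff_eq)
next
  fix A :: "'a set"
  obtain B where B: "B \<in> sets borel" "S \<inter> A \<subseteq> B" "\<mu> B = \<mu> (S \<inter> A)"
    using \<mu> unfolding radon_measure_def by metis
  have "\<mu> (S \<inter> (B \<union> - S)) = \<mu> (S \<inter> A)"
  proof (rule antisym)
    show "\<mu> (S \<inter> (B \<union> - S)) \<le> \<mu> (S \<inter> A)"
      unfolding B(3)[symmetric] by (rule radon_mono[OF \<mu>]) auto
    show "\<mu> (S \<inter> A) \<le> \<mu> (S \<inter> (B \<union> - S))"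
      using B(2) by (intro radon_mono[OF \<mu>]) auto
  qed
  moreover have "A \<subseteq> B \<union> - S" using B(2) by auto
  moreover have "B \<union> - S \<in> sets borel" using B(1) S by auto
  ultimately show "\<exists>B\<in>sets borel. A \<subseteq> B \<and> restrict_outer \<mu> S B = restrict_outer \<mu> S A"
    unfolding restrict_outer_def by metis
next
  fix K :: "'a set" assume "compact K"
  then have "\<mu> K < \<infinity>" using \<mu> by (auto simp: radon_measure_def)
  then show "restrict_outer \<mu> S K < \<infinity>"
    unfolding restrict_outer_def using radon_mono[OF \<mu>, of "S \<inter> K" K] by (meson Int_lower2 order_le_less_trans)
qed

text \<open>
  Caratheodory's theorem turns the outer measure into a measure on the Borel sets, to
  which the integration theory applies.
\<close>

definition borel_restriction :: "('a::euclidean_space set \<Rightarrow> ennreal) \<Rightarrow> 'a measure" where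
  "borel_restriction \<mu> = measure_of UNIV (sets borel) \<mu>"

lemma sets_borel_restriction [simp, measurable_cong]: "sets (borel_restriction \<mu>) = sets borel"
  and space_borel_restriction [simp]: "space (borel_restriction \<mu>) = UNIV"
  unfolding borel_restriction_def
  using sets.sigma_sets_eq[of borel] by simp_all

lemma emeasure_borel_restriction:
  fixes A :: "'a::euclidean_space set"
  assumes \<mu>: "radon_measure \<mu>" and A: "A \<in> sets borel"
  shows "emeasure (borel_restriction \<mu>) A = \<mu> A"
  unfolding borel_restriction_def
proof (rule emeasure_measure_of_sigma)
  interpret U: sigma_algebra UNIV "UNIV :: 'a set set"
    using sigma_algebra_Pow[of UNIV] by simp
  have oms: "outer_measure_space UNIV \<mu>" and sub: "sets borel \<subseteq> lambda_system UNIV UNIV \<mu>"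
    using \<mu> by (auto simp: radon_measure_def)
  have ms: "measure_space UNIV (lambda_system UNIV UNIV \<mu>) \<mu>"
    by (rule U.caratheodory_lemma[OF oms])
  show "sigma_algebra UNIV (sets (borel :: 'a measure))"
    using sets.sigma_algebra_axioms[of "borel :: 'a measure"] by simp
  show "positive (sets borel) \<mu>"
    by (simp add: positive_def radon_empty[OF \<mu>])
  show "countably_additive (sets borel) \<mu>"
    using ms sub unfolding measure_space_def countably_additive_def
    by (meson subset_trans subsetD)
qed (rule A)

section \<open>Orthogonal projections, cones and Lipschitz graphs\<close>

definition orth_proj :: "'a::euclidean_space set \<Rightarrow> 'a \<Rightarrow> 'a" where
  "orth_proj V x = (SOME p. p \<in> V \<and> x - p \<in> V\<^sup>\<bottom>)"

lemma orth_proj: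
  assumes "subspace V"
  shows orth_proj_in: "orth_proj V x \<in> V" and orth_proj_compl: "x - orth_proj V x \<in> V\<^sup>\<bottom>"
proof -
  obtain y z where yz: "y \<in> span V" "\<And>w. w \<in> span V \<Longrightarrow> orthogonal z w" "x = y + z"
    using orthogonal_subspace_decomp_exists[of V x] by metis
  then have "y \<in> V \<and> x - y \<in> V\<^sup>\<bottom>"
    using assms by (simp add: span_eq_iff[THEN iffD2] orthogonal_comp_def orthogonal_commute)
  then have "orth_proj V x \<in> V \<and> x - orth_proj V x \<in> V\<^sup>\<bottom>"
    unfolding orth_proj_def by (rule someI)
  then show "orth_proj V x \<in> V" "x - orth_proj V x \<in> V\<^sup>\<bottom>" by auto
qed

lemma orth_comp_inner: "v \<in> V \<Longrightarrow> w \<in> V\<^sup>\<bottom> \<Longrightarrow> v \<bullet> w = 0"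
  by (simp add: orthogonal_comp_def orthogonal_def)

lemma norm_add_orth_comp:
  assumes "v \<in> V" "w \<in> V\<^sup>\<bottom>"
  shows "(norm (v + w))\<^sup>2 = (norm v)\<^sup>2 + (norm w)\<^sup>2"
  using orth_comp_inner[OF assms] by (simp add: norm_add_Pythagorean orthogonal_def)

lemma orth_proj_unique:
  assumes V: "subspace V" and p: "p \<in> V" "x - p \<in> V\<^sup>\<bottom>"
  shows "orth_proj V x = p"
proof -
  have 1: "orth_proj V x - p \<in> V"
    using orth_proj_in[OF V] p V by (intro subspace_diff)
  have "(x - p) - (x - orth_proj V x) \<in> V\<^sup>\<bottom>"
    by (intro subspace_diff[OF subspace_orthogonal_comp] p orth_proj_compl[OF V])
  then have "orth_proj V x - p \<in> V\<^sup>\<bottom>" by simp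
  from orth_comp_inner[OF 1 this] show ?thesis by simp
qed

lemma orth_proj_of_mem: "subspace V \<Longrightarrow> v \<in> V \<Longrightarrow> orth_proj V v = v"
  by (rule orth_proj_unique) (auto simp: subspace_0 subspace_orthogonal_comp)

lemma orth_proj_of_compl: "subspace V \<Longrightarrow> w \<in> V\<^sup>\<bottom> \<Longrightarrow> orth_proj V w = 0"
  by (rule orth_proj_unique) (auto simp: subspace_0)

lemma linear_orth_proj: "subspace V \<Longrightarrow> linear (orth_proj V)"
proof (rule linearI)
  assume V: "subspace V"
  note W = subspace_orthogonal_comp[of V]
  show "orth_proj V (x + y) = orth_proj V x + orth_proj V y" for x y
  proof (rule orth_proj_unique[OF V])
    show "orth_proj V x + orth_proj V y \<in> V"
      by (intro subspace_add V orth_proj_in)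
    have "(x - orth_proj V x) + (y - orth_proj V y) \<in> V\<^sup>\<bottom>"
      by (intro subspace_add W orth_proj_compl V)
    then show "x + y - (orth_proj V x + orth_proj V y) \<in> V\<^sup>\<bottom>"
      by (simp add: algebra_simps)
  qed
  show "orth_proj V (c *\<^sub>R x) = c *\<^sub>R orth_proj V x" for c x
  proof (rule orth_proj_unique[OF V])
    show "c *\<^sub>R orth_proj V x \<in> V"
      by (intro subspace_scale V orth_proj_in)
    have "c *\<^sub>R (x - orth_proj V x) \<in> V\<^sup>\<bottom>"
      by (intro subspace_scale W orth_proj_compl V)
    then show "c *\<^sub>R x - c *\<^sub>R orth_proj V x \<in> V\<^sup>\<bottom>"
      by (simp add: algebra_simps)
  qed
qed

lemma norm_orth_proj_sq:
  assumes "subspace V"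
  shows "(norm x)\<^sup>2 = (norm (orth_proj V x))\<^sup>2 + (norm (x - orth_proj V x))\<^sup>2"
  using norm_add_orth_comp[OF orth_proj_in[OF assms] orth_proj_compl[OF assms], of x x] by simp

lemma norm_orth_proj_le: "subspace V \<Longrightarrow> norm (orth_proj V x) \<le> norm x"
  and norm_orth_proj_compl_le: "subspace V \<Longrightarrow> norm (x - orth_proj V x) \<le> norm x"
  by (rule power2_le_imp_le; simp add: norm_orth_proj_sq[of V x])+

lemma norm_le_orth_parts: "norm x \<le> norm (orth_proj V x) + norm (x - orth_proj V x)"
  using norm_triangle_ineq[of "orth_proj V x" "x - orth_proj V x"] by simp

lemma infdist_subspace:
  assumes V: "subspace V"
  shows "infdist x V = norm (x - orth_proj V x)"
proof (rule antisym)
  show "infdist x V \<le> norm (x - orth_proj V x)"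
    using infdist_le[OF orth_proj_in[OF V], of x x] by (simp add: dist_norm)
  have "norm (x - orth_proj V x) \<le> dist x v" if v: "v \<in> V" for v
  proof -
    have "orth_proj V (x - v) = orth_proj V x - v"
      by (simp add: linear_diff[OF linear_orth_proj[OF V]] orth_proj_of_mem[OF V v])
    then show ?thesis
      using norm_orth_proj_compl_le[OF V, of "x - v"] by (simp add: dist_norm)
  qed
  then show "norm (x - orth_proj V x) \<le> infdist x V"
    using subspace_0[OF V] by (subst infdist_notempty) (auto intro!: cINF_greatest)
qed

lemma orth_proj_orthogonal_comp:
  assumes V: "subspace V"
  shows "orth_proj (V\<^sup>\<bottom>) x = x - orth_proj V x"
  using orth_proj_compl[OF V] orth_proj_in[OF V, of x] orthogonal_comp_subset[of V]
  by (intro orth_proj_unique subspace_orthogonal_comp) auto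

lemma bad_cone_eq:
  assumes V: "subspace V"
  shows "bad_cone V \<alpha> = {x. \<alpha> * norm (orth_proj V x) < norm (x - orth_proj V x)}"
  by (simp add: bad_cone_def infdist_subspace V subspace_orthogonal_comp orth_proj_orthogonal_comp)

lemma open_bad_cone: "open (bad_cone V \<alpha>)"
  unfolding bad_cone_def by (intro open_Collect_less continuous_intros)

lemma cone_at_iff: "y \<in> cone_at X Q \<longleftrightarrow> (\<exists>x\<in>Q. y - x \<in> X)"
  by (force simp: cone_at_def)

lemma open_cone_at: "open X \<Longrightarrow> open (cone_at X Q)"
  unfolding cone_at_def by (intro open_UN ballI open_translation)

text \<open>
  Tilting the plane by a small angle can be compensated by doubling \<open>\<alpha>\<close>, which narrows the cone. The lower bound 1
  on \<open>\<alpha>'\<close> makes a vector of the new cone comparable to its part normal to the plane.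
\<close>

lemma bad_cone_subset:
  assumes V: "subspace V" and V': "subspace V'" and \<alpha>: "\<alpha> > 0"
    and \<alpha>': "\<alpha>' \<ge> 2 * \<alpha>" "\<alpha>' \<ge> 1"
    and close: "\<And>x. norm (orth_proj V x - orth_proj V' x) \<le> norm x / (4 * (1 + \<alpha>))"
  shows "bad_cone V' \<alpha>' \<subseteq> bad_cone V \<alpha>"
proof
  fix x assume "x \<in> bad_cone V' \<alpha>'"
  then have x: "\<alpha>' * norm (orth_proj V' x) < norm (x - orth_proj V' x)"
    by (simp add: bad_cone_eq V')
  define a where "a = norm (x - orth_proj V' x)"
  define b where "b = norm (orth_proj V' x)"
  define d where "d = norm (orth_proj V x - orth_proj V' x)"
  have b0: "b \<ge> 0" by (simp add: b_def)
  have b1: "2 * \<alpha> * b \<le> \<alpha>' * b" "b \<le> \<alpha>' * b"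
    using \<alpha>' b0 mult_right_mono[of 1 \<alpha>' b] by (auto intro: mult_right_mono)
  have ba: "2 * \<alpha> * b < a" "b < a"
    using x b1 by (auto simp: a_def b_def)
  have nx: "norm x < 2 * a"
    using norm_le_orth_parts[of x V'] ba by (simp add: a_def b_def)
  have "d * (4 * (1 + \<alpha>)) \<le> norm x"
    using close[of x] \<alpha> by (simp add: d_def pos_le_divide_eq)
  then have d: "d + \<alpha> * d < a / 2"
    using nx by (simp add: algebra_simps)
  have "a \<le> norm (x - orth_proj V x) + d"
    using norm_triangle_ineq[of "x - orth_proj V x" "orth_proj V x - orth_proj V' x"]
    by (simp add: a_def d_def)
  moreover have "norm (orth_proj V x) \<le> b + d"
    using norm_triangle_ineq[of "orth_proj V' x" "orth_proj V x - orth_proj V' x"]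
    by (simp add: b_def d_def)
  then have "\<alpha> * norm (orth_proj V x) \<le> \<alpha> * b + \<alpha> * d"
    using \<alpha> by (simp flip: distrib_left)
  ultimately show "x \<in> bad_cone V \<alpha>"
    using d ba by (simp add: bad_cone_eq V)
qed

lemma norm_matrix_vector_le:
  fixes A :: "real ^ 'n::finite ^ 'm::finite"
  shows "norm (A *v x) \<le> norm A * norm x"
proof -
  have "norm (A *v x) = L2_set (\<lambda>i. norm (A $ i \<bullet> x)) UNIV"
    by (simp add: norm_vec_def matrix_vector_mult_def inner_vec_def)
  also have "\<dots> \<le> L2_set (\<lambda>i. norm (A $ i) * norm x) UNIV"
    by (intro L2_set_mono) (simp_all add: Cauchy_Schwarz_ineq2)
  also have "\<dots> = norm A * norm x"
    by (simp add: norm_vec_def L2_set_left_distrib)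
  finally show ?thesis .
qed

text \<open>
  Planes are identified with the matrices of their orthogonal projections, which form a subset of a
  separable metric space.
\<close>

lemma countable_dense_grassmannian:
  obtains \<V> :: "(real ^ 'n::finite) set set"
  where "countable \<V>" "\<V> \<subseteq> grassmannian m"
    and "\<And>V e. V \<in> grassmannian m \<Longrightarrow> e > 0 \<Longrightarrow>
      \<exists>V'\<in>\<V>. \<forall>x. norm (orth_proj V x - orth_proj V' x) \<le> e * norm x"
proof -
  define M :: "(real ^ 'n) set \<Rightarrow> real ^ 'n ^ 'n" where "M = (\<lambda>V. matrix (orth_proj V))"
  obtain T where T: "countable T" "T \<subseteq> M ` grassmannian m" "M ` grassmannian m \<subseteq> closure T"
    by (rule separable)
  define \<V> where "\<V> = inv_into (grassmannian m) M ` T"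
  have M: "M V *v x = orth_proj V x" if "V \<in> grassmannian m" for V :: "(real ^ 'n) set" and x
    using that linear_orth_proj[of V]
    by (simp add: M_def grassmannian_def matrix_works linear_def scalar_mult_eq_scaleR)
  show ?thesis
  proof (rule that)
    show "countable \<V>" using T by (simp add: \<V>_def)
    show sub: "\<V> \<subseteq> grassmannian m"
      using T(2) by (auto simp: \<V>_def intro: inv_into_into)
    fix V :: "(real ^ 'n) set" and e :: real assume V: "V \<in> grassmannian m" and e: "e > 0"
    then have "M V \<in> closure T" using T(3) by auto
    then obtain A where A: "A \<in> T" "dist A (M V) < e"
      using e by (auto simp: closure_approachable)
    define V' where "V' = inv_into (grassmannian m) M A"
    have V': "V' \<in> \<V>" "M V' = A"
      using A T(2) by (auto simp: V'_def \<V>_def intro: f_inv_into_f)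
    have "norm (orth_proj V x - orth_proj V' x) \<le> e * norm x" for x
    proof -
      have "orth_proj V x - orth_proj V' x = (M V - A) *v x"
        using M[OF V] M[of V'] V' sub by (auto simp: matrix_vector_mult_diff_rdistrib)
      then have "norm (orth_proj V x - orth_proj V' x) \<le> norm (M V - A) * norm x"
        using norm_matrix_vector_le by simp
      also have "\<dots> \<le> e * norm x"
        using A(2) by (intro mult_right_mono) (auto simp: dist_norm norm_minus_commute)
      finally show ?thesis .
    qed
    with V' show "\<exists>V'\<in>\<V>. \<forall>x. norm (orth_proj V x - orth_proj V' x) \<le> e * norm x" by blast
  qed
qed

text \<open>
  McShane's extension: the infimum of the cones of slope \<open>L\<close> that stand on the graph of the function.
\<close>

lemma lipschitz_extension_real:
  fixes g :: "'a::metric_space \<Rightarrow> real"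
  assumes g: "L-lipschitz_on S g"
  obtains F where "L-lipschitz_on UNIV F" "\<And>x. x \<in> S \<Longrightarrow> F x = g x"
proof (cases "S = {}")
  case True
  have "L-lipschitz_on UNIV (\<lambda>_. 0 :: real)"
    using lipschitz_on_nonneg[OF g] by (auto intro: lipschitz_onI)
  with that True show ?thesis by blast
next
  case False
  have L: "L \<ge> 0" by (rule lipschitz_on_nonneg[OF g])
  define F where "F x = (INF p\<in>S. g p + L * dist x p)" for x
  have bdd: "bdd_below ((\<lambda>p. g p + L * dist x p) ` S)" for x
  proof -
    obtain p0 where p0: "p0 \<in> S" using False by auto
    have "g p0 - L * dist x p0 \<le> g p + L * dist x p" if "p \<in> S" for p
    proof -
      have "g p0 - g p \<le> L * dist p0 p"
        using lipschitz_onD[OF g p0 that] by (simp add: dist_real_def)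
      also have "\<dots> \<le> L * (dist x p0 + dist x p)"
        using L dist_triangle3[of p0 p x] by (intro mult_left_mono) auto
      finally show ?thesis by (simp add: algebra_simps)
    qed
    then show ?thesis by (auto intro!: bdd_belowI2)
  qed
  have le: "F x \<le> F y + L * dist x y" for x y
  proof -
    have "F x - L * dist x y \<le> g p + L * dist y p" if "p \<in> S" for p
    proof -
      have "F x \<le> g p + L * dist x p"
        unfolding F_def by (rule cINF_lower[OF bdd that])
      also have "L * dist x p \<le> L * (dist x y + dist y p)"
        using L dist_triangle by (intro mult_left_mono) auto
      finally show ?thesis by (simp add: algebra_simps)
    qed
    then have "F x - L * dist x y \<le> F y"
      unfolding F_def[of y] by (intro cINF_greatest False)
    then show ?thesis by simp
  qed
  have "L-lipschitz_on UNIV F"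
  proof (rule lipschitz_onI[OF _ L])
    fix x y
    show "dist (F x) (F y) \<le> L * dist x y"
      using le[of x y] le[of y x] by (simp add: dist_real_def dist_commute abs_le_iff)
  qed
  moreover have "F x = g x" if x: "x \<in> S" for x
  proof (rule antisym)
    show "F x \<le> g x" unfolding F_def using cINF_lower[OF bdd x, of x] by simp
    have "g x \<le> g p + L * dist x p" if "p \<in> S" for p
      using lipschitz_onD[OF g x that] by (simp add: dist_real_def abs_le_iff)
    then show "g x \<le> F x" unfolding F_def by (intro cINF_greatest False)
  qed
  ultimately show ?thesis using that by blast
qed

text \<open>
  Extending coordinatewise loses a dimensional factor in the constant, which is harmless for the
  notion of a Lipschitz graph.
\<close>

lemma lipschitz_extension:
  fixes g :: "'a::metric_space \<Rightarrow> 'b::euclidean_space"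
  assumes g: "L-lipschitz_on S g"
  obtains F K where "K-lipschitz_on UNIV F" "\<And>x. x \<in> S \<Longrightarrow> F x = g x"
proof -
  have "\<exists>F. L-lipschitz_on UNIV F \<and> (\<forall>x\<in>S. F x = g x \<bullet> b)" if b: "b \<in> Basis" for b
  proof -
    have "L-lipschitz_on S (\<lambda>x. g x \<bullet> b)"
    proof (rule lipschitz_onI[OF _ lipschitz_on_nonneg[OF g]])
      fix x y assume xy: "x \<in> S" "y \<in> S"
      have "dist (g x \<bullet> b) (g y \<bullet> b) \<le> dist (g x) (g y)"
        using Basis_le_norm[OF b, of "g x - g y"] by (simp add: dist_norm inner_diff_left)
      with lipschitz_onD[OF g xy] show "dist (g x \<bullet> b) (g y \<bullet> b) \<le> L * dist x y" by simp
    qed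
    then show ?thesis by (rule lipschitz_extension_real) blast
  qed
  then obtain F where F: "\<And>b. b \<in> Basis \<Longrightarrow> L-lipschitz_on UNIV (F b)"
      "\<And>b x. b \<in> Basis \<Longrightarrow> x \<in> S \<Longrightarrow> F b x = g x \<bullet> b"
    by metis
  have "(\<Sum>b\<in>(Basis :: 'b set). L)-lipschitz_on UNIV (\<lambda>x. \<Sum>b\<in>Basis. F b x *\<^sub>R b)"
  proof (rule lipschitz_onI)
    fix x y
    have "dist (\<Sum>b\<in>Basis. F b x *\<^sub>R b) (\<Sum>b\<in>Basis. F b y *\<^sub>R b)
        = norm (\<Sum>b\<in>Basis. (F b x - F b y) *\<^sub>R b)"
      by (simp add: dist_norm scaleR_diff_left sum_subtractf)
    also have "\<dots> \<le> (\<Sum>b\<in>(Basis :: 'b set). L * dist x y)"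
    proof (rule sum_norm_le)
      fix b :: 'b assume b: "b \<in> Basis"
      show "norm ((F b x - F b y) *\<^sub>R b) \<le> L * dist x y"
        using lipschitz_onD[OF F(1)[OF b], of x y] b by (simp add: dist_real_def)
    qed
    finally show "dist (\<Sum>b\<in>Basis. F b x *\<^sub>R b) (\<Sum>b\<in>Basis. F b y *\<^sub>R b)
        \<le> (\<Sum>b\<in>(Basis :: 'b set). L) * dist x y"
      by (simp add: mult.assoc)
  qed (simp add: lipschitz_on_nonneg[OF g])
  moreover have "(\<Sum>b\<in>Basis. F b x *\<^sub>R b) = g x" if "x \<in> S" for x
    using F(2) that by (simp add: euclidean_representation)
  ultimately show ?thesis using that by blast
qed

text \<open>
  The cone condition says that the projection to \<open>V\<close> is injective on \<open>P\<close> and that the normal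
  coordinate is a Lipschitz function of the projection; this function is extended to \<open>V\<close> and projected back to
  the orthogonal complement.
\<close>

lemma subset_lipschitz_graph:
  assumes V: "V \<in> grassmannian m" and \<alpha>: "\<alpha> \<ge> 0"
    and cone: "\<And>x y. x \<in> P \<Longrightarrow> y \<in> P \<Longrightarrow> y - x \<notin> bad_cone V \<alpha>"
  obtains \<Gamma> where "\<Gamma> \<in> lipschitz_graphs m" "P \<subseteq> \<Gamma>"
proof -
  let ?\<pi> = "orth_proj V"
  have sub: "subspace V" using V by (simp add: grassmannian_def)
  note lin = linear_orth_proj[OF sub]
  have le: "norm ((y - ?\<pi> y) - (x - ?\<pi> x)) \<le> \<alpha> * norm (?\<pi> y - ?\<pi> x)" if "x \<in> P" "y \<in> P" for x y
    using cone[OF that] by (simp add: bad_cone_eq sub linear_diff[OF lin] algebra_simps not_less)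
  have inj: "x = y" if xy: "x \<in> P" "y \<in> P" "?\<pi> x = ?\<pi> y" for x y
    using le[OF xy(1,2)] xy(3) by simp
  define g where "g v = inv_into P ?\<pi> v - v" for v
  have inv: "inv_into P ?\<pi> (?\<pi> x) = x" if "x \<in> P" for x
    using that inj by (intro inv_into_f_f inj_onI)
  have g: "g (?\<pi> x) = x - ?\<pi> x" if "x \<in> P" for x
    using inv[OF that] by (simp add: g_def)
  have "\<alpha>-lipschitz_on (?\<pi> ` P) g"
  proof (rule lipschitz_onI[OF _ \<alpha>], elim imageE, hypsubst)
    fix x y assume xy: "x \<in> P" "y \<in> P"
    show "dist (g (?\<pi> x)) (g (?\<pi> y)) \<le> \<alpha> * dist (?\<pi> x) (?\<pi> y)"
      using le[OF xy(2,1)] by (simp add: g xy dist_norm)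
  qed
  then obtain F K where F: "K-lipschitz_on UNIV F" "\<And>v. v \<in> ?\<pi> ` P \<Longrightarrow> F v = g v"
    by (rule lipschitz_extension) blast
  define f where "f v = F v - ?\<pi> (F v)" for v
  have f: "f ` V \<subseteq> V\<^sup>\<bottom>"
    by (auto simp: f_def intro: orth_proj_compl[OF sub])
  have "K-lipschitz_on V f"
  proof (rule lipschitz_onI[OF _ lipschitz_on_nonneg[OF F(1)]])
    fix u v
    have "dist (f u) (f v) \<le> dist (F u) (F v)"
      using norm_orth_proj_compl_le[OF sub, of "F u - F v"]
      by (simp add: f_def dist_norm linear_diff[OF lin] algebra_simps)
    also have "\<dots> \<le> K * dist u v" using lipschitz_onD[OF F(1)] by simp
    finally show "dist (f u) (f v) \<le> K * dist u v" .
  qed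
  then have "{x + f x | x. x \<in> V} \<in> lipschitz_graphs m"
    unfolding lipschitz_graphs_def using V f by blast
  moreover have "P \<subseteq> {x + f x | x. x \<in> V}"
  proof
    fix x assume x: "x \<in> P"
    have "f (?\<pi> x) = x - ?\<pi> x"
      using F(2)[of "?\<pi> x"] x g[OF x] orth_proj_of_compl[OF sub orth_proj_compl[OF sub, of x]]
      by (simp add: f_def)
    then have "x = ?\<pi> x + f (?\<pi> x)" by simp
    then show "x \<in> {x + f x | x. x \<in> V}" using orth_proj_in[OF sub] by blast
  qed
  ultimately show ?thesis by (rule that)
qed

lemma lipschitz_graph_cases:
  assumes "\<Gamma> \<in> lipschitz_graphs m"
  obtains V f L where "V \<in> grassmannian m" "L-lipschitz_on V f"
    "\<Gamma> = {y. y - orth_proj V y = f (orth_proj V y)}"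
proof -
  obtain V f L where V: "V \<in> grassmannian m" and f: "f ` V \<subseteq> V\<^sup>\<bottom>" and L: "L-lipschitz_on V f"
    and \<Gamma>: "\<Gamma> = {x + f x | x. x \<in> V}"
    using assms unfolding lipschitz_graphs_def by blast
  have sub: "subspace V" using V by (simp add: grassmannian_def)
  have "orth_proj V (x + f x) = x" if "x \<in> V" for x
    using f that by (intro orth_proj_unique[OF sub]) auto
  then have "\<Gamma> = {y. y - orth_proj V y = f (orth_proj V y)}"
    unfolding \<Gamma> using orth_proj_in[OF sub]
    by auto (metis diff_add_cancel add.commute)
  with V L that show ?thesis by blast
qed

lemma closed_lipschitz_graph:
  assumes "\<Gamma> \<in> lipschitz_graphs m"
  shows "closed \<Gamma>"
proof -
  obtain V f L where V: "V \<in> grassmannian m" and L: "L-lipschitz_on V f"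
    and \<Gamma>: "\<Gamma> = {y. y - orth_proj V y = f (orth_proj V y)}"
    using assms by (rule lipschitz_graph_cases)
  have sub: "subspace V" using V by (simp add: grassmannian_def)
  have c: "continuous_on UNIV (orth_proj V)"
    by (rule linear_continuous_on[OF linear_linear[THEN iffD2, OF linear_orth_proj[OF sub]]])
  have "continuous_on UNIV (\<lambda>y. f (orth_proj V y))"
    by (rule continuous_on_compose2[OF lipschitz_on_continuous_on[OF L] c])
       (use orth_proj_in[OF sub] in auto)
  with c show ?thesis
    unfolding \<Gamma> by (intro closed_Collect_eq continuous_intros)
qed

lemma grassmannian_nonempty:
  assumes "m \<le> DIM('a::euclidean_space)"
  obtains V :: "'a::euclidean_space set" where "V \<in> grassmannian m"
  using choose_subspace_of_subspace[of m "UNIV :: 'a set"] assms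
  by (auto simp: grassmannian_def)

lemma lipschitz_graphs_nonempty:
  assumes "m \<le> DIM('a::euclidean_space)"
  obtains \<Gamma> :: "'a::euclidean_space set" where "\<Gamma> \<in> lipschitz_graphs m"
proof -
  obtain V :: "'a set" where "V \<in> grassmannian m"
    using grassmannian_nonempty[OF assms] .
  then show ?thesis
    using subset_lipschitz_graph[of V m 0 "{}"] that by auto
qed

section \<open>Sums over nested countable partitions\<close>

text \<open>
  The partitions are given by labelling functions \<open>c\<close> with countably many values; the cells are
  the level sets.
\<close>

lemma nn_integral_over_cells:
  fixes c :: "'a \<Rightarrow> 'i::countable" and g :: "'i \<Rightarrow> ennreal"
  assumes c [measurable]: "c \<in> M \<rightarrow>\<^sub>M count_space UNIV" and A [measurable]: "A \<in> sets M"
  shows "(\<integral>\<^sup>+x. g (c x) * indicator A x \<partial>M)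
    = (\<integral>\<^sup>+j. g j * emeasure M (A \<inter> {x \<in> space M. c x = j}) \<partial>count_space UNIV)"
proof -
  have "g (c x) * indicator A x
      = (\<integral>\<^sup>+j. g j * indicator (A \<inter> {x \<in> space M. c x = j}) x \<partial>count_space UNIV)"
    if "x \<in> space M" for x
  proof -
    have "(\<integral>\<^sup>+j. g j * indicator (A \<inter> {x \<in> space M. c x = j}) x \<partial>count_space UNIV)
        = (\<integral>\<^sup>+j. g j * indicator A x * indicator {c x} j \<partial>count_space UNIV)"
      using that by (intro nn_integral_cong) (auto simp: indicator_def)
    also have "\<dots> = g (c x) * indicator A x"
      by (subst nn_integral_indicator_singleton) auto
    finally show ?thesis ..
  qed
  then have "(\<integral>\<^sup>+x. g (c x) * indicator A x \<partial>M)
      = (\<integral>\<^sup>+x. \<integral>\<^sup>+j. g j * indicator (A \<inter> {x \<in> space M. c x = j}) x \<partial>count_space UNIV \<partial>M)"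
    by (rule nn_integral_cong)
  also have "\<dots> = (\<integral>\<^sup>+j. \<integral>\<^sup>+x. g j * indicator (A \<inter> {x \<in> space M. c x = j}) x \<partial>M \<partial>count_space UNIV)"
    by (rule nn_integral_count_space_nn_integral) auto
  also have "\<dots> = (\<integral>\<^sup>+j. g j * emeasure M (A \<inter> {x \<in> space M. c x = j}) \<partial>count_space UNIV)"
    by (intro nn_integral_cong nn_integral_cmult_indicator) measurable
  finally show ?thesis .
qed

lemma emeasure_over_cells:
  fixes c :: "'a \<Rightarrow> 'i::countable"
  assumes "c \<in> M \<rightarrow>\<^sub>M count_space UNIV" "A \<in> sets M"
  shows "emeasure M A = (\<integral>\<^sup>+j. emeasure M (A \<inter> {x \<in> space M. c x = j}) \<partial>count_space UNIV)"
  using nn_integral_over_cells[OF assms, of "\<lambda>_. 1"] assms(2) by simp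

lemma nested_cells:
  fixes c :: "nat \<Rightarrow> 'a \<Rightarrow> 'i"
  assumes nested: "\<And>k x y. c (Suc k) x = c (Suc k) y \<Longrightarrow> c k x = c k y"
  shows "i \<le> k \<Longrightarrow> c k x = c k y \<Longrightarrow> c i x = c i y"
  by (induction k rule: dec_induct) (auto dest: nested)

text \<open>
  A weak-type maximal inequality. The cells of low density that come first
  in their branch of the nested partitions are disjoint, and each contributes at most the fraction \<open>\<eta>\<close>
  of its own measure.
\<close>

lemma emeasure_low_density_le:
  fixes c :: "nat \<Rightarrow> 'a \<Rightarrow> 'i::countable"
  defines "cell \<equiv> \<lambda>M k j. {x \<in> space M. c k x = j}"
  assumes c [measurable]: "\<And>k. c k \<in> M \<rightarrow>\<^sub>M count_space UNIV"
    and nested: "\<And>k x y. c (Suc k) x = c (Suc k) y \<Longrightarrow> c k x = c k y"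
    and A [measurable]: "A \<in> sets M"
  shows "emeasure M {x \<in> A. \<exists>k. emeasure M (A \<inter> cell M k (c k x)) \<le> \<eta> * emeasure M (cell M k (c k x))}
    \<le> \<eta> * emeasure M (space M)"
proof -
  define bad where "bad k j \<longleftrightarrow> emeasure M (A \<inter> cell M k j) \<le> \<eta> * emeasure M (cell M k j)" for k j
  define F where "F k = {x \<in> space M. bad k (c k x) \<and> (\<forall>i<k. \<not> bad i (c i x))}" for k
  have [measurable]: "Measurable.pred M (\<lambda>x. bad k (c k x))" for k
    by (rule measurable_compose[OF c]) simp
  have F [measurable]: "F k \<in> sets M" for k
    unfolding F_def by measurable
  have [measurable]: "cell M k j \<in> sets M" for k j
    unfolding cell_def by measurable
  have step: "emeasure M (A \<inter> F k) \<le> \<eta> * emeasure M (F k)" for k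
  proof -
    have "emeasure M (A \<inter> F k \<inter> cell M k j) \<le> \<eta> * emeasure M (F k \<inter> cell M k j)" for j
    proof (cases "F k \<inter> cell M k j = {}")
      case True
      then have "A \<inter> F k \<inter> cell M k j = {}" by blast
      then show ?thesis by simp
    next
      case False
      then obtain x where x: "x \<in> F k" "c k x = j" by (auto simp: cell_def)
      have "cell M k j \<subseteq> F k"
      proof
        fix y assume y: "y \<in> cell M k j"
        then have "c i y = c i x" if "i \<le> k" for i
          using nested_cells[of c, OF nested that, of y x] x by (simp add: cell_def)
        then show "y \<in> F k" using x y by (auto simp: F_def cell_def)
      qed
      then have "F k \<inter> cell M k j = cell M k j" "A \<inter> F k \<inter> cell M k j = A \<inter> cell M k j" by auto
      moreover have "bad k j" using x by (auto simp: F_def)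
      ultimately show ?thesis by (simp add: bad_def)
    qed
    then have "emeasure M (A \<inter> F k) \<le> (\<integral>\<^sup>+j. \<eta> * emeasure M (F k \<inter> cell M k j) \<partial>count_space UNIV)"
      unfolding emeasure_over_cells[OF c, of "A \<inter> F k" k, simplified] cell_def
      by (intro nn_integral_mono) simp
    also have "\<dots> = \<eta> * emeasure M (F k)"
      unfolding emeasure_over_cells[OF c F, of k k] cell_def by (rule nn_integral_cmult) simp
    finally show ?thesis .
  qed
  have disj: "disjoint_family F"
    by (auto simp: disjoint_family_on_def F_def) (metis linorder_neqE_nat)
  have "{x \<in> A. \<exists>k. bad k (c k x)} = (\<Union>k. A \<inter> F k)"
  proof (intro set_eqI iffI)
    fix x assume "x \<in> {x \<in> A. \<exists>k. bad k (c k x)}"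
    then have x: "x \<in> A" "\<exists>k. bad k (c k x)" by auto
    define k where "k = (LEAST k. bad k (c k x))"
    have "bad k (c k x)" using LeastI_ex[OF x(2)] by (simp add: k_def)
    moreover have "\<forall>i<k. \<not> bad i (c i x)" by (auto simp: k_def dest: not_less_Least)
    ultimately have "x \<in> A \<inter> F k"
      using x(1) sets.sets_into_space[OF A] by (auto simp: F_def)
    then show "x \<in> (\<Union>k. A \<inter> F k)" by blast
  qed (auto simp: F_def)
  then have "emeasure M {x \<in> A. \<exists>k. bad k (c k x)} = emeasure M (\<Union>k. A \<inter> F k)" by simp
  also have "\<dots> \<le> (\<Sum>k. emeasure M (A \<inter> F k))"
    by (rule emeasure_subadditive_countably) auto
  also have "\<dots> \<le> (\<Sum>k. \<eta> * emeasure M (F k))"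
    by (intro suminf_le step) auto
  also have "\<dots> = \<eta> * emeasure M (\<Union>k. F k)"
    using disj by (simp add: suminf_emeasure image_subset_iff)
  also have "\<dots> \<le> \<eta> * emeasure M (space M)"
    by (intro mult_left_mono emeasure_space) simp
  finally show ?thesis unfolding bad_def .
qed

text \<open>
  The sets \<open>W k j\<close> will be the conical annuli and \<open>h k j\<close> their defects. Call a cell good if \<open>A\<close>
  fills more than the fraction \<open>\<eta>\<close> of it. On good cells the measure of \<open>W k j\<close> is at most \<open>1/\<eta>\<close> times
  the integral of \<open>h k\<close> over the part of \<open>A\<close> in the cell, so the unions of these sets over the good cells
  of one generation have summable measures and Borel--Cantelli applies. The points of \<open>A\<close> that lie in some cell that is not good
  have measure at most \<open>\<eta>\<close> times the total mass, and \<open>\<eta>\<close> runs through a null sequence.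
\<close>

lemma eventually_avoid_bounded:
  fixes c :: "nat \<Rightarrow> 'a \<Rightarrow> 'i::countable" and h :: "nat \<Rightarrow> 'i \<Rightarrow> ennreal" and C :: ennreal
  assumes M: "finite_measure M"
    and c [measurable]: "\<And>k. c k \<in> M \<rightarrow>\<^sub>M count_space UNIV"
    and nested: "\<And>k x y. c (Suc k) x = c (Suc k) y \<Longrightarrow> c k x = c k y"
    and A [measurable]: "A \<in> sets M"
    and W [measurable]: "\<And>k j. W k j \<in> sets M"
    and W_le: "\<And>k j. emeasure M {x \<in> space M. c k x = j} > 0 \<Longrightarrow>
      emeasure M (W k j) \<le> h k j * emeasure M {x \<in> space M. c k x = j}"
    and bound: "\<And>x. x \<in> A \<Longrightarrow> (\<Sum>k. h k (c k x)) \<le> C" and C: "C < \<infinity>"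
  obtains \<L> where "countable \<L>" "\<L> \<subseteq> sets M" "A - \<Union>\<L> \<in> null_sets M"
    "\<And>L. L \<in> \<L> \<Longrightarrow> \<exists>k0. \<forall>x\<in>L. \<forall>y\<in>L. \<forall>k\<ge>k0. y \<notin> W k (c k x)"
proof -
  interpret finite_measure M by (rule M)
  define cell where "cell k j = {x \<in> space M. c k x = j}" for k j
  define \<eta> :: "nat \<Rightarrow> real" where "\<eta> p = inverse (real (Suc p))" for p
  define good where "good p k j \<longleftrightarrow> ennreal (\<eta> p) * emeasure M (cell k j) < emeasure M (A \<inter> cell k j)" for p k j
  define G where "G p = {x \<in> A. \<forall>k. good p k (c k x)}" for p
  define E where "E p k = (\<Union>j\<in>{j. good p k j}. W k j)" for p k
  define L where "L p k0 = {x \<in> G p. \<forall>k\<ge>k0. x \<notin> E p k}" for p k0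
  have A_space: "A \<subseteq> space M" by (rule sets.sets_into_space[OF A])
  have [measurable]: "cell k j \<in> sets M" for k j
    unfolding cell_def by measurable
  have [measurable]: "Measurable.pred M (\<lambda>x. good p k (c k x))" for p k
    by (rule measurable_compose[OF c]) simp
  have G_eq: "G p = A \<inter> {x \<in> space M. \<forall>k. good p k (c k x)}" for p
    using A_space by (auto simp: G_def)
  have [measurable]: "G p \<in> sets M" for p
    unfolding G_eq by measurable
  have E [measurable]: "E p k \<in> sets M" for p k
    unfolding E_def by (intro sets.countable_UN') auto
  have L_eq: "L p k0 = G p - (\<Union>k\<in>{k0..}. E p k)" for p k0
    by (auto simp: L_def)
  have [measurable]: "L p k0 \<in> sets M" for p k0
    unfolding L_eq by measurable
  have \<eta>: "\<eta> p > 0" for p by (simp add: \<eta>_def)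

  have low: "emeasure M (A - G p) \<le> ennreal (\<eta> p) * emeasure M (space M)" for p
  proof -
    have "\<not> good p k j \<longleftrightarrow> emeasure M (A \<inter> cell k j) \<le> ennreal (\<eta> p) * emeasure M (cell k j)" for k j
      by (simp add: good_def not_less)
    moreover have "A - G p = {x \<in> A. \<exists>k. \<not> good p k (c k x)}"
      by (auto simp: G_def)
    ultimately show ?thesis
      using emeasure_low_density_le[of c M A "ennreal (\<eta> p)", OF c nested A] by (simp add: cell_def)
  qed

  have sum_E: "(\<Sum>k. emeasure M (E p k)) < \<infinity>" for p
  proof -
    have "ennreal (\<eta> p) * emeasure M (E p k) \<le> (\<integral>\<^sup>+x. h k (c k x) * indicator A x \<partial>M)" for k
    proof -
      have "ennreal (\<eta> p) * emeasure M (W k j) * indicator {j. good p k j} j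
          \<le> h k j * emeasure M (A \<inter> cell k j)" for j
      proof (cases "good p k j")
        case True
        then have pos: "emeasure M (cell k j) > 0"
          using emeasure_mono[of "A \<inter> cell k j" "cell k j" M]
          by (metis Int_lower2 good_def \<open>\<And>j k. cell k j \<in> sets M\<close> leD not_gr_zero zero_le)
        have "ennreal (\<eta> p) * emeasure M (W k j) \<le> ennreal (\<eta> p) * (h k j * emeasure M (cell k j))"
          using W_le pos by (intro mult_left_mono) (auto simp: cell_def)
        also have "\<dots> = h k j * (ennreal (\<eta> p) * emeasure M (cell k j))"
          by (simp add: mult_ac)
        also have "\<dots> \<le> h k j * emeasure M (A \<inter> cell k j)"
          using True by (intro mult_left_mono) (auto simp: good_def)
        finally show ?thesis using True by simp
      qed simp
      then have "(\<integral>\<^sup>+j. ennreal (\<eta> p) * emeasure M (W k j) * indicator {j. good p k j} j \<partial>count_space UNIV)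
          \<le> (\<integral>\<^sup>+x. h k (c k x) * indicator A x \<partial>M)"
        unfolding nn_integral_over_cells[OF c A] cell_def by (intro nn_integral_mono)
      moreover have "emeasure M (E p k)
          \<le> (\<integral>\<^sup>+j. emeasure M (W k j) * indicator {j. good p k j} j \<partial>count_space UNIV)"
      proof -
        have "emeasure M (E p k) = (\<integral>\<^sup>+x. indicator (E p k) x \<partial>M)" by simp
        also have "\<dots> \<le> (\<integral>\<^sup>+x. \<integral>\<^sup>+j. indicator {j. good p k j} j * indicator (W k j) x \<partial>count_space UNIV \<partial>M)"
        proof (intro nn_integral_mono)
          fix x
          show "indicator (E p k) x
              \<le> (\<integral>\<^sup>+j. indicator {j. good p k j} j * indicator (W k j) x \<partial>count_space UNIV :: ennreal)"
          proof (cases "x \<in> E p k")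
            case True
            then obtain j where j: "good p k j" "x \<in> W k j" by (auto simp: E_def)
            have "(1::ennreal) = (\<integral>\<^sup>+i. indicator {j} i \<partial>count_space UNIV)" by simp
            also have "\<dots> \<le> (\<integral>\<^sup>+j. indicator {j. good p k j} j * indicator (W k j) x \<partial>count_space UNIV)"
              using j by (intro nn_integral_mono) (auto simp: indicator_def)
            finally show ?thesis using True by simp
          qed simp
        qed
        also have "\<dots> = (\<integral>\<^sup>+j. \<integral>\<^sup>+x. indicator {j. good p k j} j * indicator (W k j) x \<partial>M \<partial>count_space UNIV)"
          by (rule nn_integral_count_space_nn_integral) auto
        also have "\<dots> = (\<integral>\<^sup>+j. emeasure M (W k j) * indicator {j. good p k j} j \<partial>count_space UNIV)"
          by (intro nn_integral_cong, subst nn_integral_cmult_indicator) (auto simp: mult.commute)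
        finally show ?thesis .
      qed
      then have "ennreal (\<eta> p) * emeasure M (E p k)
          \<le> ennreal (\<eta> p) * (\<integral>\<^sup>+j. emeasure M (W k j) * indicator {j. good p k j} j \<partial>count_space UNIV)"
        by (intro mult_left_mono) auto
      ultimately show ?thesis
        by (simp add: nn_integral_cmult mult.assoc)
    qed
    then have "(\<Sum>k. ennreal (\<eta> p) * emeasure M (E p k)) \<le> (\<Sum>k. \<integral>\<^sup>+x. h k (c k x) * indicator A x \<partial>M)"
      by (intro suminf_le) auto
    also have "\<dots> = (\<integral>\<^sup>+x. (\<Sum>k. h k (c k x) * indicator A x) \<partial>M)"
      by (rule nn_integral_suminf[symmetric]) 
        (intro borel_measurable_times_ennreal measurable_compose[OF c] borel_measurable_indicator A; simp)
    also have "\<dots> \<le> (\<integral>\<^sup>+x. C \<partial>M)"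
      using bound by (intro nn_integral_mono) (auto simp: indicator_def)
    also have "\<dots> < \<infinity>"
      using C emeasure_finite by (simp add: ennreal_mult_eq_top_iff flip: less_top)
    finally have "ennreal (\<eta> p) * (\<Sum>k. emeasure M (E p k)) < \<infinity>" by simp
    then show ?thesis
      using \<eta>[of p] by (auto simp: ennreal_mult_less_top)
  qed

  show ?thesis
  proof (rule that)
    show "countable (range (\<lambda>(p, k0). L p k0))" "range (\<lambda>(p, k0). L p k0) \<subseteq> sets M" by auto
    fix X assume "X \<in> range (\<lambda>(p, k0). L p k0)"
    then obtain p k0 where X: "X = L p k0" by auto
    have "y \<notin> W k (c k x)" if "x \<in> X" "y \<in> X" "k \<ge> k0" for x y k
      using that by (auto simp: X L_def G_def E_def)
    then show "\<exists>k0. \<forall>x\<in>X. \<forall>y\<in>X. \<forall>k\<ge>k0. y \<notin> W k (c k x)" by blast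
  next
    have lim: "limsup (E p) \<in> null_sets M" for p
    proof (rule borel_cantelli_limsup1)
      show "emeasure M (E p k) < \<infinity>" for k
        using emeasure_finite by (simp flip: less_top)
      show "summable (\<lambda>k. measure M (E p k))"
        using sum_E[of p] by (intro summable_suminf_not_top) (simp_all add: emeasure_eq_measure)
    qed simp
    have "(\<Inter>p. A - G p) \<in> null_sets M"
    proof (rule null_setsI)
      show "(\<Inter>p. A - G p) \<in> sets M" by measurable
      have "emeasure M (\<Inter>p. A - G p) \<le> ennreal (\<eta> p) * emeasure M (space M)" for p
        by (rule order_trans[OF emeasure_mono low]) auto
      then have "emeasure M (\<Inter>p. A - G p) \<le> ennreal (\<eta> p * measure M (space M))" for p
        using \<eta>[of p] by (simp add: ennreal_mult' emeasure_eq_measure less_imp_le)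
      moreover have "(\<lambda>p. \<eta> p * measure M (space M)) \<longlonglongrightarrow> 0"
        unfolding \<eta>_def by (intro tendsto_mult_left_zero LIMSEQ_inverse_real_of_nat)
      then have "(\<lambda>p. ennreal (\<eta> p * measure M (space M))) \<longlonglongrightarrow> ennreal 0"
        by (rule tendsto_ennrealI)
      ultimately show "emeasure M (\<Inter>p. A - G p) = 0"
        by (metis LIMSEQ_le_const ennreal_0 le_zero_eq)
    qed
    moreover have "(\<Union>p. limsup (E p)) \<in> null_sets M"
      using lim by blast
    ultimately have N: "(\<Inter>p. A - G p) \<union> (\<Union>p. limsup (E p)) \<in> null_sets M"
      by (rule null_sets.Un)
    have sub: "A - \<Union>(range (\<lambda>(p, k0). L p k0)) \<subseteq> (\<Inter>p. A - G p) \<union> (\<Union>p. limsup (E p))"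
    proof
      fix x assume x: "x \<in> A - \<Union>(range (\<lambda>(p, k0). L p k0))"
      show "x \<in> (\<Inter>p. A - G p) \<union> (\<Union>p. limsup (E p))"
      proof (rule ccontr)
        assume n: "x \<notin> (\<Inter>p. A - G p) \<union> (\<Union>p. limsup (E p))"
        then obtain p where p: "x \<in> G p" "x \<notin> limsup (E p)" using x by auto
        then obtain k0 where "\<forall>k\<ge>k0. x \<notin> E p k" by (auto simp: limsup_INF_SUP)
        then have "x \<in> L p k0" using p by (auto simp: L_def)
        then show False using x by auto
      qed
    qed
    have "A - \<Union>(range (\<lambda>(p, k0). L p k0)) \<in> sets M"
      by (intro sets.Diff A sets.countable_Union) auto
    then show "A - \<Union>(range (\<lambda>(p, k0). L p k0)) \<in> null_sets M"
      by (rule null_sets_subset[OF N _ sub])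
  qed
qed

text \<open>
  The set where the sum is finite is exhausted by the sets where it is bounded.
\<close>

lemma eventually_avoid:
  fixes c :: "nat \<Rightarrow> 'a \<Rightarrow> 'i::countable" and h :: "nat \<Rightarrow> 'i \<Rightarrow> ennreal"
  assumes M: "finite_measure M"
    and c [measurable]: "\<And>k. c k \<in> M \<rightarrow>\<^sub>M count_space UNIV"
    and nested: "\<And>k x y. c (Suc k) x = c (Suc k) y \<Longrightarrow> c k x = c k y"
    and A [measurable]: "A \<in> sets M"
    and W [measurable]: "\<And>k j. W k j \<in> sets M"
    and W_le: "\<And>k j. emeasure M {x \<in> space M. c k x = j} > 0 \<Longrightarrow>
      emeasure M (W k j) \<le> h k j * emeasure M {x \<in> space M. c k x = j}"
    and finite: "\<And>x. x \<in> A \<Longrightarrow> (\<Sum>k. h k (c k x)) < \<infinity>"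
  obtains \<L> where "countable \<L>" "\<L> \<subseteq> sets M" "A - \<Union>\<L> \<in> null_sets M"
    "\<And>L. L \<in> \<L> \<Longrightarrow> \<exists>k0. \<forall>x\<in>L. \<forall>y\<in>L. \<forall>k\<ge>k0. y \<notin> W k (c k x)"
proof -
  define B where "B N = A \<inter> {x \<in> space M. (\<Sum>k. h k (c k x)) \<le> of_nat N}" for N :: nat
  have [measurable]: "(\<lambda>x. h k (c k x)) \<in> borel_measurable M" for k
    by (rule measurable_compose[OF c]) simp
  have B: "B N \<in> sets M" for N unfolding B_def by measurable
  have "\<exists>\<L>. countable \<L> \<and> \<L> \<subseteq> sets M \<and> B N - \<Union>\<L> \<in> null_sets M \<and>
    (\<forall>L\<in>\<L>. \<exists>k0. \<forall>x\<in>L. \<forall>y\<in>L. \<forall>k\<ge>k0. y \<notin> W k (c k x))" (is "?goal N") for N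
  proof (rule eventually_avoid_bounded[OF M c nested B[of N] W W_le])
    show "(\<Sum>k. h k (c k x)) \<le> of_nat N" if "x \<in> B N" for x
      using that by (simp add: B_def)
    show "of_nat N < (\<infinity> :: ennreal)" by (simp add: of_nat_less_top)
    fix \<K> assume \<K>: "countable \<K>" "\<K> \<subseteq> sets M" "B N - \<Union>\<K> \<in> null_sets M"
      "\<And>L. L \<in> \<K> \<Longrightarrow> \<exists>k0. \<forall>x\<in>L. \<forall>y\<in>L. \<forall>k\<ge>k0. y \<notin> W k (c k x)"
    show "?goal N" by (rule exI[of _ \<K>]) (intro conjI ballI \<K>)
  qed
  then obtain \<L> where \<L>: "\<And>N. countable (\<L> N)" "\<And>N. \<L> N \<subseteq> sets M" "\<And>N. B N - \<Union>(\<L> N) \<in> null_sets M"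
    "\<And>N L. L \<in> \<L> N \<Longrightarrow> \<exists>k0. \<forall>x\<in>L. \<forall>y\<in>L. \<forall>k\<ge>k0. y \<notin> W k (c k x)"
    by metis
  have A_B: "A \<subseteq> (\<Union>N. B N)"
  proof
    fix x assume x: "x \<in> A"
    then obtain N :: nat where "(\<Sum>k. h k (c k x)) < of_nat N"
      using finite ennreal_Ex_less_of_nat[of "\<Sum>k. h k (c k x)"] by auto
    then show "x \<in> (\<Union>N. B N)" using x sets.sets_into_space[OF A] by (auto simp: B_def intro: less_imp_le)
  qed
  show ?thesis
  proof (rule that)
    show "countable (\<Union>N. \<L> N)" "(\<Union>N. \<L> N) \<subseteq> sets M" using \<L>(1,2) by auto
    show "\<exists>k0. \<forall>x\<in>L. \<forall>y\<in>L. \<forall>k\<ge>k0. y \<notin> W k (c k x)" if "L \<in> (\<Union>N. \<L> N)" for L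
    proof -
      from that obtain N where "L \<in> \<L> N" by (rule UN_E)
      then show ?thesis by (rule \<L>(4))
    qed
    have "(\<Union>N. B N - \<Union>(\<L> N)) \<in> null_sets M"
      by (rule null_sets_UN[OF \<L>(3)])
    moreover have "A - \<Union>(\<Union>N. \<L> N) \<subseteq> (\<Union>N. B N - \<Union>(\<L> N))"
    proof (rule subsetI)
      fix x assume x: "x \<in> A - \<Union>(\<Union>N. \<L> N)"
      have "x \<in> (\<Union>N. B N)" by (rule subsetD[OF A_B DiffD1[OF x]])
      then obtain N where N: "x \<in> B N" by (rule UN_E)
      have "x \<notin> \<Union>(\<L> N)" using x by simp
      with N show "x \<in> (\<Union>N. B N - \<Union>(\<L> N))" by (intro UN_I[of N] DiffI UNIV_I)
    qed
    moreover have "A - \<Union>(\<Union>N. \<L> N) \<in> sets M"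
      using \<L>(1,2) by (intro sets.Diff A sets.countable_Union) auto
    ultimately show "A - \<Union>(\<Union>N. \<L> N) \<in> null_sets M"
      using null_sets_subset by blast
  qed
qed

text \<open>
  A converse to \<open>eventually_avoid\<close>: if the sets \<open>W k j\<close> that belong to cells meeting \<open>A\<close> have bounded
  overlap, then exchanging sum and integral bounds the integral of the sum over \<open>A\<close>.
\<close>

lemma suminf_finite_AE:
  fixes c :: "nat \<Rightarrow> 'a \<Rightarrow> 'i::countable" and h :: "nat \<Rightarrow> 'i \<Rightarrow> ennreal" and C :: ennreal
  assumes M: "finite_measure M"
    and c [measurable]: "\<And>k. c k \<in> M \<rightarrow>\<^sub>M count_space UNIV"
    and A [measurable]: "A \<in> sets M"
    and W [measurable]: "\<And>k j. W k j \<in> sets M"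
    and le_W: "\<And>k j. A \<inter> {x \<in> space M. c k x = j} \<noteq> {} \<Longrightarrow>
      h k j * emeasure M {x \<in> space M. c k x = j} \<le> emeasure M (W k j)"
    and bound: "\<And>y. (\<Sum>k. emeasure (count_space UNIV) {j. A \<inter> {x \<in> space M. c k x = j} \<noteq> {} \<and> y \<in> W k j}) \<le> C"
    and C: "C < \<infinity>"
  shows "AE x in M. x \<in> A \<longrightarrow> (\<Sum>k. h k (c k x)) < \<infinity>"
proof -
  interpret finite_measure M by (rule M)
  define J where "J k = {j. A \<inter> {x \<in> space M. c k x = j} \<noteq> {}}" for k
  have hm [measurable]: "(\<lambda>x. h k (c k x)) \<in> borel_measurable M" for k
    by (rule measurable_compose[OF c]) simp
  have count: "(\<integral>\<^sup>+j. indicator (J k) j * indicator (W k j) y \<partial>count_space UNIV)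
      = emeasure (count_space UNIV) {j \<in> J k. y \<in> W k j}" for k y
  proof -
    have "(\<integral>\<^sup>+j. indicator (J k) j * indicator (W k j) y \<partial>count_space UNIV)
        = (\<integral>\<^sup>+j. indicator {j \<in> J k. y \<in> W k j} j \<partial>count_space UNIV :: ennreal)"
      by (intro nn_integral_cong) (auto simp: indicator_def)
    then show ?thesis by simp
  qed
  have "(\<integral>\<^sup>+x. (\<Sum>k. h k (c k x) * indicator A x) \<partial>M) = (\<Sum>k. \<integral>\<^sup>+x. h k (c k x) * indicator A x \<partial>M)"
    by (rule nn_integral_suminf) measurable
  also have "\<dots> \<le> (\<Sum>k. \<integral>\<^sup>+y. emeasure (count_space UNIV) {j \<in> J k. y \<in> W k j} \<partial>M)"
  proof (intro suminf_le)
    fix k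
    have "(\<integral>\<^sup>+x. h k (c k x) * indicator A x \<partial>M)
        \<le> (\<integral>\<^sup>+j. indicator (J k) j * emeasure M (W k j) \<partial>count_space UNIV)"
      unfolding nn_integral_over_cells[OF c A]
    proof (intro nn_integral_mono)
      fix j
      show "h k j * emeasure M (A \<inter> {x \<in> space M. c k x = j}) \<le> indicator (J k) j * emeasure M (W k j)"
      proof (cases "j \<in> J k")
        case True
        have "h k j * emeasure M (A \<inter> {x \<in> space M. c k x = j}) \<le> h k j * emeasure M {x \<in> space M. c k x = j}"
          by (intro mult_left_mono emeasure_mono) auto
        also have "\<dots> \<le> emeasure M (W k j)" using True le_W by (simp add: J_def)
        finally show ?thesis using True by simp
      qed (simp add: J_def)
    qed
    also have "\<dots> = (\<integral>\<^sup>+j. \<integral>\<^sup>+y. indicator (J k) j * indicator (W k j) y \<partial>M \<partial>count_space UNIV)"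
      by (simp add: nn_integral_cmult_indicator)
    also have "\<dots> = (\<integral>\<^sup>+y. \<integral>\<^sup>+j. indicator (J k) j * indicator (W k j) y \<partial>count_space UNIV \<partial>M)"
      by (rule nn_integral_count_space_nn_integral[symmetric]) auto
    also have "\<dots> = (\<integral>\<^sup>+y. emeasure (count_space UNIV) {j \<in> J k. y \<in> W k j} \<partial>M)"
      by (simp add: count)
    finally show "(\<integral>\<^sup>+x. h k (c k x) * indicator A x \<partial>M)
        \<le> (\<integral>\<^sup>+y. emeasure (count_space UNIV) {j \<in> J k. y \<in> W k j} \<partial>M)" .
  qed auto
  also have "\<dots> = (\<integral>\<^sup>+y. (\<Sum>k. emeasure (count_space UNIV) {j \<in> J k. y \<in> W k j}) \<partial>M)"
  proof (rule nn_integral_suminf[symmetric])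
    fix k
    have "(\<lambda>p. indicator (J k) (fst p) * indicator (W k (fst p)) (snd p) :: ennreal)
        \<in> borel_measurable (count_space UNIV \<Otimes>\<^sub>M M)"
      by (rule measurable_pair_measure_countable1) auto
    then have "(\<lambda>(y, j). indicator (J k) j * indicator (W k j) y :: ennreal)
        \<in> borel_measurable (M \<Otimes>\<^sub>M count_space UNIV)"
      by (subst measurable_pair_swap_iff) (simp add: case_prod_beta)
    then have "(\<lambda>y. \<integral>\<^sup>+j. indicator (J k) j * indicator (W k j) y \<partial>count_space UNIV :: ennreal) \<in> borel_measurable M"
      by (rule sigma_finite_measure.borel_measurable_nn_integral[OF sigma_finite_measure_count_space])
    then show "(\<lambda>y. emeasure (count_space UNIV) {j \<in> J k. y \<in> W k j}) \<in> borel_measurable M"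
      by (simp add: count)
  qed
  also have "\<dots> \<le> (\<integral>\<^sup>+y. C \<partial>M)"
    using bound by (intro nn_integral_mono) (simp add: J_def)
  also have "\<dots> < \<infinity>"
    using C emeasure_finite by (simp add: ennreal_mult_eq_top_iff flip: less_top)
  finally have "AE x in M. (\<Sum>k. h k (c k x) * indicator A x) \<noteq> \<infinity>"
    by (intro nn_integral_PInf_AE) auto
  then show ?thesis
    by eventually_elim (auto simp: less_top)
qed

section \<open>Dyadic cells and the conical defect\<close>

text \<open>
  Generation \<open>k\<close> consists of the dyadic cubes of side \<open>2^-k\<close>. Labelling points by the integer coordinates of
  their cube gives the nested partitions to which the lemmas of the previous part apply.
\<close>

definition cell_index :: "nat \<Rightarrow> real ^ 'n::finite \<Rightarrow> 'n \<Rightarrow> int" where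
  "cell_index k x = (\<lambda>i. \<lfloor>x $ i * 2 ^ k\<rfloor>)"

abbreviation small_cube :: "nat \<Rightarrow> ('n \<Rightarrow> int) \<Rightarrow> (real ^ 'n::finite) set" where
  "small_cube k j \<equiv> dyadic_cube (int k) j"

lemma mem_dyadic_cube_iff: "x \<in> small_cube k j \<longleftrightarrow> cell_index k x = j"
proof -
  have "of_int (j i) * 2 powi (- int k) \<le> x $ i \<and> x $ i < (of_int (j i) + 1) * 2 powi (- int k)
      \<longleftrightarrow> \<lfloor>x $ i * 2 ^ k\<rfloor> = j i" for i
    by (simp add: floor_eq_iff power_int_minus field_simps)
  then show ?thesis
    by (simp add: dyadic_cube_def cell_index_def fun_eq_iff)
qed

lemma mem_own_cube: "x \<in> small_cube k (cell_index k x)"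
  by (simp add: mem_dyadic_cube_iff)

lemma cell_index_nested:
  assumes "cell_index (Suc k) x = cell_index (Suc k) y"
  shows "cell_index k x = cell_index k y"
proof -
  have "\<lfloor>z $ i * 2 ^ k\<rfloor> = \<lfloor>z $ i * 2 ^ Suc k\<rfloor> div 2" for z :: "real ^ 'n" and i
    using floor_divide_real_eq_div[of 2 "z $ i * 2 ^ Suc k"] by simp
  then show ?thesis
    using assms by (metis cell_index_def ext)
qed

lemma borel_dyadic_cube [measurable]:
  fixes j :: "'n::finite \<Rightarrow> int"
  shows "dyadic_cube k j \<in> sets borel"
proof -
  have "dyadic_cube k j = (\<Inter>i. {x :: real ^ 'n. of_int (j i) * 2 powi (-k) \<le> x $ i} \<inter> {x :: real ^ 'n. x $ i < (of_int (j i) + 1) * 2 powi (-k)})"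
    by (auto simp: dyadic_cube_def)
  moreover have "{x :: real ^ 'n. of_int (j i) * 2 powi (-k) \<le> x $ i} \<inter> {x :: real ^ 'n. x $ i < (of_int (j i) + 1) * 2 powi (-k)} \<in> sets borel" for i
    by (intro sets.Int borel_closed borel_open closed_Collect_le open_Collect_less continuous_intros)
  ultimately show ?thesis
    by (auto intro!: sets.finite_INT)
qed

lemma measurable_cell_index [measurable]: "cell_index k \<in> borel \<rightarrow>\<^sub>M count_space UNIV"
proof -
  have "cell_index k -` {j} = small_cube k j" for j :: "'a \<Rightarrow> int"
    by (auto simp: mem_dyadic_cube_iff)
  then show ?thesis
    by (subst measurable_count_space_eq2_countable) auto
qed

definition small_cube_center :: "nat \<Rightarrow> ('n::finite \<Rightarrow> int) \<Rightarrow> real ^ 'n" where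
  "small_cube_center k j = (\<chi> i. (of_int (j i) + 1/2) / 2 ^ k)"

lemma cube_center_small_cube: "cube_center (small_cube k j) = small_cube_center k j"
  by (simp add: small_cube_center_def power_int_minus field_simps)

lemma cube_side_small_cube: "cube_side (small_cube k j) = 1 / 2 ^ k"
  by (simp add: power_int_minus field_simps)

lemma center_in_cube: "small_cube_center k j \<in> small_cube k j"
  by (simp add: mem_dyadic_cube_iff cell_index_def small_cube_center_def fun_eq_iff floor_eq_iff)

lemma norm_le_components:
  fixes x :: "real ^ 'n::finite"
  assumes "\<And>i. \<bar>x $ i\<bar> \<le> e"
  shows "norm x \<le> sqrt (real CARD('n)) * e"
proof -
  have e: "e \<ge> 0" using assms[of undefined] by linarith
  have "norm x \<le> L2_set (\<lambda>i::'n. e) UNIV"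
    unfolding norm_vec_def using assms by (intro L2_set_mono) auto
  also have "\<dots> = sqrt (real CARD('n)) * e"
    using e by (simp add: L2_set_def real_sqrt_mult)
  finally show ?thesis .
qed

lemma dist_in_cube_le:
  fixes x y :: "real ^ 'n::finite"
  assumes "x \<in> small_cube k j" "y \<in> small_cube k j"
  shows "dist x y \<le> sqrt (real CARD('n)) / 2 ^ k"
proof -
  have "\<bar>(x - y) $ i\<bar> \<le> 1 / 2 ^ k" for i
    using assms by (auto simp: dyadic_cube_def power_int_minus field_simps abs_le_iff dest!: spec[of _ i])
  then show ?thesis
    using norm_le_components[of "x - y" "1 / 2 ^ k"] by (simp add: dist_norm)
qed

lemma bounded_small_cube: "bounded (small_cube k j)"
  unfolding bounded_def using dist_in_cube_le[OF center_in_cube[of k j]] by blast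

lemma radon_bounded_finite:
  assumes "radon_measure \<mu>" "bounded S"
  shows "\<mu> S < \<infinity>"
proof -
  have "\<mu> (closure S) < \<infinity>"
    using assms by (simp add: radon_measure_def)
  then show ?thesis
    using radon_mono[OF assms(1) closure_subset[of S]] by (rule order_le_less_trans[rotated])
qed

lemma suminf_eq_infsum_ennreal:
  fixes f :: "nat \<Rightarrow> ennreal"
  shows "infsum f UNIV = (\<Sum>k. f k)"
  by (intro sums_unique has_sum_imp_sums has_sum_infsum nonneg_summable_on_complete) simp

lemma powi_two_inject: "(2::real) powi a = 2 powi b \<Longrightarrow> a = b"
  using power_int_strict_increasing[of a b "2::real"] power_int_strict_increasing[of b a "2::real"]
  by (cases a b rule: linorder_cases) auto

text \<open>
  A point lies in exactly one cube of each generation.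
\<close>

lemma conical_dini_eq_suminf:
  "conical_dini \<mu> V \<alpha> x = (\<Sum>k. defect \<mu> (small_cube k (cell_index k x)) V \<alpha>)"
proof -
  define q where "q k = small_cube k (cell_index k x)" for k
  have inj: "inj q"
    by (auto simp: q_def inj_def dyadic_cube_eq_iff)
  have "conical_dini \<mu> V \<alpha> x = infsum (\<lambda>Q. defect \<mu> Q V \<alpha>) (range q)"
    unfolding conical_dini_def
  proof (rule infsum_cong_neutral)
    fix Q assume "Q \<in> range q - {Q \<in> dyadic_cubes. cube_side Q \<le> 1}"
    then show "defect \<mu> Q V \<alpha> = 0"
      by (auto simp: q_def dyadic_cubes_def cube_side_small_cube simp del: cube_side_dyadic_cube)
  next
    fix Q :: "(real ^ 'a) set" assume Q: "Q \<in> {Q \<in> dyadic_cubes. cube_side Q \<le> 1} - range q"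
    then obtain k j where kj: "Q = dyadic_cube k j" by (auto simp: dyadic_cubes_def)
    have "k \<ge> 0"
      using Q power_int_strict_increasing[of 0 "- k" "2::real"] by (force simp: kj)
    then obtain k' where k': "k = int k'" by (rule nonneg_int_cases)
    have "x \<notin> Q"
      using Q by (auto simp: kj k' mem_dyadic_cube_iff q_def)
    then show "defect \<mu> Q V \<alpha> * indicator Q x = 0" by simp
  next
    fix Q assume "Q \<in> {Q \<in> dyadic_cubes. cube_side Q \<le> 1} \<inter> range q"
    then have "x \<in> Q" by (auto simp: q_def mem_own_cube)
    then show "defect \<mu> Q V \<alpha> * indicator Q x = defect \<mu> Q V \<alpha>" by simp
  qed
  also have "\<dots> = infsum (\<lambda>k. defect \<mu> (q k) V \<alpha>) UNIV"
    using infsum_reindex[OF inj, of "\<lambda>Q. defect \<mu> Q V \<alpha>"] by (simp add: o_def)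
  finally show ?thesis
    by (simp add: suminf_eq_infsum_ennreal q_def)
qed

lemma cone_cubes_small:
  assumes "R \<in> cone_cubes (small_cube k j) V \<alpha>"
  obtains i where "R = small_cube k i"
proof -
  obtain k' i where R: "R = dyadic_cube k' i" "cube_side R = cube_side (small_cube k j)"
    using assms unfolding cone_cubes_def dyadic_cubes_def by blast
  then have "k' = int k" using powi_two_inject[of "-k'" "- int k"] by simp
  with R that show ?thesis by simp
qed

lemma small_cube_in_cone_cubes:
  assumes "y \<in> cone_annulus (small_cube k j) V \<alpha>"
  shows "small_cube k (cell_index k y) \<in> cone_cubes (small_cube k j) V \<alpha>"
  using assms mem_own_cube[of y k]
  by (auto simp: cone_cubes_def dyadic_cubes_def cube_side_small_cube)

definition cone_region :: "(real ^ 'n::finite) set \<Rightarrow> real \<Rightarrow> nat \<Rightarrow> ('n \<Rightarrow> int) \<Rightarrow> (real ^ 'n) set" where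
  "cone_region V \<alpha> k j = \<Union>(cone_cubes (small_cube k j) V \<alpha>)"

lemma finite_cone_cubes_small: "finite (cone_cubes (small_cube k j) V \<alpha>)"
  by (rule finite_cone_cubes) (auto simp: dyadic_cubes_def)

lemma borel_cone_region [measurable]: "cone_region V \<alpha> k j \<in> sets borel"
  unfolding cone_region_def
proof (rule sets.finite_Union[OF finite_cone_cubes_small], rule subsetI)
  fix R assume "R \<in> cone_cubes (small_cube k j) V \<alpha>"
  then show "R \<in> sets borel" by (rule cone_cubes_small) simp
qed

lemma defect_mult:
  assumes \<mu>: "radon_measure \<mu>" and pos: "\<mu> (small_cube k j) > 0"
  shows "defect \<mu> (small_cube k j) V \<alpha> * \<mu> (small_cube k j) = \<mu> (cone_region V \<alpha> k j)"
proof -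
  let ?Q = "small_cube k j" and ?M = "borel_restriction \<mu>"
  let ?\<R> = "cone_cubes ?Q V \<alpha>"
  have fin: "\<mu> ?Q \<noteq> \<infinity>"
    using radon_bounded_finite[OF \<mu> bounded_small_cube[of k j]] by simp
  have R: "R \<in> sets borel" if "R \<in> ?\<R>" for R
    using that by (rule cone_cubes_small) simp
  have disj: "disjoint_family_on (\<lambda>R. R) ?\<R>"
    unfolding disjoint_family_on_def
  proof (intro ballI impI)
    fix R R' assume "R \<in> ?\<R>" "R' \<in> ?\<R>" "R \<noteq> R'"
    then show "R \<inter> R' = {}"
      by (elim cone_cubes_small) (auto simp: mem_dyadic_cube_iff)
  qed
  have "a / \<mu> ?Q * \<mu> ?Q = a" for a
    using ennreal_divide_self[of "\<mu> ?Q"] pos fin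
    by (simp only: ennreal_divide_times less_top[symmetric] zero_less_iff_neq_zero) simp
  then have "defect \<mu> ?Q V \<alpha> * \<mu> ?Q = (\<Sum>R\<in>?\<R>. \<mu> R)"
    using pos by (simp add: defect_def sum_distrib_right)
  also have "\<dots> = (\<Sum>R\<in>?\<R>. emeasure ?M R)"
    using R by (intro sum.cong) (auto simp: emeasure_borel_restriction[OF \<mu>])
  also have "\<dots> = emeasure ?M (\<Union>R\<in>?\<R>. R)"
    using R disj finite_cone_cubes_small by (intro sum_emeasure) auto
  also have "\<dots> = \<mu> (cone_region V \<alpha> k j)"
    using emeasure_borel_restriction[OF \<mu> borel_cone_region[of V \<alpha> k j]] by (simp add: cone_region_def)
  finally show ?thesis .
qed

text \<open>
  Cutting \<open>\<mu>\<close> off outside a ball makes it finite without changing it near a given bounded set.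
\<close>

definition ball_restriction :: "('a::euclidean_space set \<Rightarrow> ennreal) \<Rightarrow> real \<Rightarrow> 'a measure" where
  "ball_restriction \<mu> r = density (borel_restriction \<mu>) (indicator (ball 0 r))"

lemma sets_ball_restriction [simp, measurable_cong]: "sets (ball_restriction \<mu> r) = sets borel"
  and space_ball_restriction [simp]: "space (ball_restriction \<mu> r) = UNIV"
  by (simp_all add: ball_restriction_def)

lemma emeasure_ball_restriction:
  assumes "radon_measure \<mu>" "A \<in> sets borel"
  shows "emeasure (ball_restriction \<mu> r) A = \<mu> (ball 0 r \<inter> A)"
  using assms by (simp add: ball_restriction_def emeasure_restricted emeasure_borel_restriction)

lemma finite_measure_ball_restriction:
  assumes "radon_measure \<mu>"
  shows "finite_measure (ball_restriction \<mu> r)"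
  using radon_bounded_finite[OF assms bounded_ball[of 0 r]]
  by (intro finite_measureI) (simp add: emeasure_ball_restriction[OF assms])

definition graph_coverable :: "('a::euclidean_space set \<Rightarrow> ennreal) \<Rightarrow> nat \<Rightarrow> 'a set \<Rightarrow> bool" where
  "graph_coverable \<mu> m A \<longleftrightarrow> (\<exists>\<G>. countable \<G> \<and> \<G> \<subseteq> lipschitz_graphs m \<and> \<mu> (A - \<Union>\<G>) = 0)"

lemma graph_coverable_subset:
  "radon_measure \<mu> \<Longrightarrow> graph_coverable \<mu> m B \<Longrightarrow> A \<subseteq> B \<Longrightarrow> graph_coverable \<mu> m A"
  unfolding graph_coverable_def by (meson radon_null_mono Diff_mono subset_refl)

lemma graph_coverable_UN:
  assumes \<mu>: "radon_measure \<mu>" and I: "countable I" and A: "\<And>i. i \<in> I \<Longrightarrow> graph_coverable \<mu> m (A i)"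
  shows "graph_coverable \<mu> m (\<Union>i\<in>I. A i)"
proof -
  obtain \<G> where \<G>: "\<And>i. i \<in> I \<Longrightarrow> countable (\<G> i)" "\<And>i. i \<in> I \<Longrightarrow> \<G> i \<subseteq> lipschitz_graphs m"
      "\<And>i. i \<in> I \<Longrightarrow> \<mu> (A i - \<Union>(\<G> i)) = 0"
    using A unfolding graph_coverable_def by metis
  have "\<mu> (\<Union>i\<in>I. A i - \<Union>(\<G> i)) = 0"
    by (rule radon_null_UN_countable[OF \<mu> I \<G>(3)])
  then have "\<mu> ((\<Union>i\<in>I. A i) - \<Union>(\<Union>i\<in>I. \<G> i)) = 0"
    by (rule radon_null_mono[OF \<mu>, rotated]) auto
  moreover have "countable (\<Union>i\<in>I. \<G> i)" "(\<Union>i\<in>I. \<G> i) \<subseteq> lipschitz_graphs m"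
    using \<G> I by auto
  ultimately show ?thesis unfolding graph_coverable_def by blast
qed

lemma graph_coverable_null:
  "\<mu> A = 0 \<Longrightarrow> graph_coverable \<mu> m A"
  unfolding graph_coverable_def by (intro exI[of _ "{}"]) simp

section \<open>Points of finite conical Dini function are covered by graphs\<close>

text \<open>
  The integer parameter \<open>t\<close> makes the family of annuli countable. The ratio of the radii exceeds 2 by
  enough that, when \<open>x\<close> runs through a cube, the annuli of successive generations around \<open>x\<close> still
  leave no gap after they have been moved to the centre of the cube.
\<close>

definition inner_cone_region :: "(real ^ 'n::finite) set \<Rightarrow> real \<Rightarrow> nat \<Rightarrow> nat \<Rightarrow> ('n \<Rightarrow> int) \<Rightarrow> (real ^ 'n) set" where
  "inner_cone_region V \<alpha> t k j = cone_at (bad_cone V \<alpha>) (small_cube k j) \<inter>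
     {y. real t * sqrt (real CARD('n)) / 2 ^ k \<le> dist y (small_cube_center k j)
       \<and> dist y (small_cube_center k j) \<le> (2 * real t + 3) * sqrt (real CARD('n)) / 2 ^ k}"

lemma borel_inner_cone_region [measurable]: "inner_cone_region V \<alpha> t k j \<in> sets borel"
  unfolding inner_cone_region_def
  by (rule sets.Int[OF borel_open borel_closed])
    (intro open_cone_at open_bad_cone closed_Collect_conj closed_Collect_le continuous_intros)+

lemma dyadic_scale:
  fixes d e :: real
  assumes "0 < d" "d \<le> e / 2 ^ k0"
  obtains k where "k \<ge> k0" "e / 2 ^ k \<le> d" "d \<le> 2 * e / 2 ^ k"
proof -
  define P where "P k \<longleftrightarrow> k \<ge> k0 \<and> e / 2 ^ k \<le> d" for k :: nat
  obtain k1 :: nat where "e / d < 2 ^ k1"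
    using real_arch_pow[of 2 "e / d"] by auto
  then have "e / 2 ^ k1 \<le> d"
    using assms by (simp add: field_simps)
  moreover have e: "e \<ge> 0" using assms by (simp add: field_simps) (meson less_imp_le order_trans mult_pos_pos zero_less_numeral zero_less_power)
  moreover have "e / 2 ^ (max k0 k1) \<le> e / 2 ^ k1"
    using e by (intro divide_left_mono power_increasing) auto
  ultimately have "P (max k0 k1)" by (auto simp: P_def)
  then have P: "P (LEAST k. P k)" by (rule LeastI)
  define k where "k = (LEAST k. P k)"
  have "d \<le> 2 * e / 2 ^ k"
  proof (cases "k = k0")
    case True
    have "e / 2 ^ k0 \<le> 2 * e / 2 ^ k0" using e by (intro divide_right_mono) auto
    then show ?thesis using assms True by simp
  next
    case False
    then have "k > k0" using P by (auto simp: P_def k_def)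
    then obtain k' where k': "k = Suc k'" "k' \<ge> k0" by (cases k) auto
    then have "\<not> P k'" unfolding k_def by (metis lessI not_less_Least)
    then show ?thesis using k' by (simp add: P_def)
  qed
  then show ?thesis using that[of k] P by (auto simp: P_def k_def)
qed

text \<open>
  If \<open>x\<close> and \<open>y\<close> lie in one small cube and \<open>y - x\<close> is in the cone, then \<open>y\<close> lies in the annulus of
  the cube around \<open>x\<close> whose side matches the distance of the two points. Hence the part of \<open>L\<close> in each cube of
  generation \<open>k0\<close> satisfies the cone condition.
\<close>

lemma avoid_imp_graph_coverable:
  fixes L :: "(real ^ 'n::finite) set"
  assumes \<mu>: "radon_measure \<mu>" and V: "V \<in> grassmannian m" and \<alpha>: "\<alpha> \<ge> 0"
    and avoid: "\<And>x y k. x \<in> L \<Longrightarrow> y \<in> L \<Longrightarrow> k \<ge> k0 \<Longrightarrow> y \<notin> inner_cone_region V \<alpha> t k (cell_index k x)"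
  shows "graph_coverable \<mu> m L"
proof -
  define s where "s = sqrt (real CARD('n))"
  have s: "s > 0" by (simp add: s_def)
  have piece: "graph_coverable \<mu> m (L \<inter> small_cube k0 j)" for j
  proof -
    have "y - x \<notin> bad_cone V \<alpha>" if x: "x \<in> L \<inter> small_cube k0 j" and y: "y \<in> L \<inter> small_cube k0 j" for x y
    proof
      assume cone: "y - x \<in> bad_cone V \<alpha>"
      have sub: "subspace V" using V by (simp add: grassmannian_def)
      have "0 \<notin> bad_cone V \<alpha>"
        by (simp add: bad_cone_eq[OF sub] orth_proj_of_mem[OF sub subspace_0[OF sub]])
      then have "x \<noteq> y" using cone by auto
      then have d: "dist x y > 0" by simp
      have "dist x y \<le> s / 2 ^ k0"
        using dist_in_cube_le[of x k0 j y] x y by (simp add: s_def)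
      also have "\<dots> \<le> (real t + 1) * s / 2 ^ k0"
        using s by (intro divide_right_mono) (auto simp: distrib_right)
      finally obtain k where k: "k \<ge> k0" "(real t + 1) * s / 2 ^ k \<le> dist x y"
          "dist x y \<le> 2 * ((real t + 1) * s) / 2 ^ k"
        using dyadic_scale[OF d] by blast
      let ?c = "small_cube_center k (cell_index k x)"
      have c: "dist x ?c \<le> s / 2 ^ k"
        using dist_in_cube_le[OF mem_own_cube center_in_cube, of x k] by (simp add: s_def)
      have "dist x y \<le> dist y ?c + dist x ?c" "dist y ?c \<le> dist x y + dist x ?c"
        using dist_triangle[of y ?c x] dist_triangle2[of x y ?c] by (simp_all add: dist_commute)
      then have "real t * s / 2 ^ k \<le> dist y ?c" "dist y ?c \<le> (2 * real t + 3) * s / 2 ^ k"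
        using c k(2,3) by (simp_all add: distrib_right add_divide_distrib)
      moreover have "y \<in> cone_at (bad_cone V \<alpha>) (small_cube k (cell_index k x))"
        using cone mem_own_cube[of x k] by (auto simp: cone_at_iff)
      ultimately have "y \<in> inner_cone_region V \<alpha> t k (cell_index k x)"
        by (simp add: inner_cone_region_def s_def)
      then show False using avoid[of x y k] x y k(1) by auto
    qed
    then obtain \<Gamma> where "\<Gamma> \<in> lipschitz_graphs m" "L \<inter> small_cube k0 j \<subseteq> \<Gamma>"
      using subset_lipschitz_graph[OF V \<alpha>, of "L \<inter> small_cube k0 j"] by metis
    then show ?thesis
      unfolding graph_coverable_def
      by (intro exI[of _ "{\<Gamma>}"]) (auto simp: radon_empty[OF \<mu>] Diff_eq_empty_iff[THEN iffD2])
  qed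
  have "L = (\<Union>j. L \<inter> small_cube k0 j)"
    using mem_own_cube by blast
  then show ?thesis
    using graph_coverable_UN[OF \<mu> _ piece, of UNIV "\<lambda>j. j"] by simp
qed

definition inner_defect ::
  "((real ^ 'n::finite) set \<Rightarrow> ennreal) \<Rightarrow> (real ^ 'n) set \<Rightarrow> real \<Rightarrow> nat \<Rightarrow> nat \<Rightarrow> ('n \<Rightarrow> int) \<Rightarrow> ennreal" where
  "inner_defect \<mu> V \<alpha> t k j =
    (if \<mu> (small_cube k j) > 0 then \<mu> (inner_cone_region V \<alpha> t k j) / \<mu> (small_cube k j) else 0)"

definition inner_dini ::
  "((real ^ 'n::finite) set \<Rightarrow> ennreal) \<Rightarrow> (real ^ 'n) set \<Rightarrow> real \<Rightarrow> nat \<Rightarrow> real ^ 'n \<Rightarrow> ennreal" where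
  "inner_dini \<mu> V \<alpha> t x = (\<Sum>k. inner_defect \<mu> V \<alpha> t k (cell_index k x))"

text \<open>
  In a ball the lemma \<open>eventually_avoid\<close> applies to the finite measure that is cut off outside a
  slightly larger ball. The defects \<open>h\<close> are formed with the cut-off measure; they agree with or lie
  below the original ones at points whose cubes stay inside.
\<close>

lemma inner_dini_graph_coverable:
  fixes \<mu> :: "(real ^ 'n::finite) set \<Rightarrow> ennreal"
  assumes \<mu>: "radon_measure \<mu>" and V: "V \<in> grassmannian m" and \<alpha>: "\<alpha> \<ge> 0"
  shows "graph_coverable \<mu> m {x. inner_dini \<mu> V \<alpha> t x < \<infinity>}"
proof -
  define s where "s = sqrt (real CARD('n))"
  have s: "s > 0" by (simp add: s_def)
  define A where "A r = {x. inner_dini \<mu> V \<alpha> t x < \<infinity>} \<inter> ball 0 (real r)" for r :: nat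
  have "graph_coverable \<mu> m (A r)" for r
  proof -
    let ?M = "ball_restriction \<mu> (real r + s)"
    let ?Q = "\<lambda>k j. small_cube k j :: (real ^ 'n) set" and ?W = "inner_cone_region V \<alpha> t"
    define h where "h k j = (if emeasure ?M (?Q k j) > 0 then emeasure ?M (?W k j) / emeasure ?M (?Q k j) else 0)" for k j
    have cell: "{x \<in> space ?M. cell_index k x = j} = ?Q k j" for k j
      by (auto simp: mem_dyadic_cube_iff)
    have hm: "(\<lambda>x. inner_defect \<mu> V \<alpha> t k (cell_index k x)) \<in> borel_measurable borel" for k
      by (rule measurable_compose[OF measurable_cell_index]) simp
    have A: "A r \<in> sets ?M"
    proof -
      have "inner_dini \<mu> V \<alpha> t \<in> borel_measurable borel"
        unfolding inner_dini_def[abs_def] by (intro borel_measurable_suminf_order hm)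
      then show ?thesis unfolding A_def by auto
    qed
    have le: "h k (cell_index k x) \<le> inner_defect \<mu> V \<alpha> t k (cell_index k x)" if x: "x \<in> A r" for x k
    proof -
      let ?j = "cell_index k x"
      have "?Q k ?j \<subseteq> ball 0 (real r + s)"
      proof
        fix y assume y: "y \<in> ?Q k ?j"
        have "dist x y \<le> s / 2 ^ k"
          using dist_in_cube_le[OF mem_own_cube y] by (simp add: s_def)
        also have "\<dots> \<le> s / 1" by (intro divide_left_mono) (auto simp: s_def)
        finally have "dist x y \<le> s" by simp
        then show "y \<in> ball 0 (real r + s)"
          using x dist_triangle[of 0 y x] by (auto simp: A_def)
      qed
      then have "emeasure ?M (?Q k ?j) = \<mu> (?Q k ?j)"
        by (simp add: emeasure_ball_restriction[OF \<mu>] Int_absorb1)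
      moreover have "emeasure ?M (?W k ?j) \<le> \<mu> (?W k ?j)"
        by (simp add: emeasure_ball_restriction[OF \<mu>] radon_mono[OF \<mu>])
      ultimately show ?thesis
        by (auto simp: h_def inner_defect_def intro!: divide_right_mono_ennreal)
    qed
    have fin_M: "emeasure ?M X \<noteq> \<infinity>" for X
      using finite_measure.emeasure_finite[OF finite_measure_ball_restriction[OF \<mu>]] by simp
    obtain \<L> where \<L>: "countable \<L>" "A r - \<Union>\<L> \<in> null_sets ?M"
      "\<And>L. L \<in> \<L> \<Longrightarrow> \<exists>k0. \<forall>x\<in>L. \<forall>y\<in>L. \<forall>k\<ge>k0. y \<notin> ?W k (cell_index k x)"
    proof (rule eventually_avoid[of ?M cell_index "A r" ?W h])
      show "emeasure ?M (?W k j) \<le> h k j * emeasure ?M {x \<in> space ?M. cell_index k x = j}"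
        if "emeasure ?M {x \<in> space ?M. cell_index k x = j} > 0" for k j
      proof -
        have "a / emeasure ?M (?Q k j) * emeasure ?M (?Q k j) = a" for a
          using ennreal_divide_self[of "emeasure ?M (?Q k j)"] that fin_M[of "?Q k j"] unfolding cell
          by (simp only: ennreal_divide_times less_top[symmetric] zero_less_iff_neq_zero) simp
        then show ?thesis using that unfolding cell by (simp add: h_def)
      qed
      show "(\<Sum>k. h k (cell_index k x)) < \<infinity>" if x: "x \<in> A r" for x
      proof -
        have "(\<Sum>k. h k (cell_index k x)) \<le> inner_dini \<mu> V \<alpha> t x"
          unfolding inner_dini_def by (intro suminf_le le[OF x]) auto
        also have "\<dots> < \<infinity>" using x by (simp add: A_def)
        finally show ?thesis .
      qed
    qed (use A cell_index_nested finite_measure_ball_restriction[OF \<mu>] in auto)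
    have cov: "graph_coverable \<mu> m L" if "L \<in> \<L>" for L
      using \<L>(3)[OF that] avoid_imp_graph_coverable[OF \<mu> V \<alpha>, of L _ t] by blast
    have "\<mu> (ball 0 (real r + s) \<inter> (A r - \<Union>\<L>)) = 0"
      using \<L>(2) emeasure_ball_restriction[OF \<mu>, of "A r - \<Union>\<L>" "real r + s"]
      by (auto simp: null_sets_def)
    moreover have "ball 0 (real r + s) \<inter> (A r - \<Union>\<L>) = A r - \<Union>\<L>"
      using s by (auto simp: A_def)
    ultimately have "graph_coverable \<mu> m (A r - \<Union>\<L>)"
      by (intro graph_coverable_null) simp
    then have "graph_coverable \<mu> m (\<Union>X\<in>insert (A r - \<Union>\<L>) \<L>. X)"
      using \<L>(1) cov by (intro graph_coverable_UN[OF \<mu>]) auto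
    then show ?thesis
      by (rule graph_coverable_subset[OF \<mu>]) auto
  qed
  then have "graph_coverable \<mu> m (\<Union>r. A r)"
    by (intro graph_coverable_UN[OF \<mu>]) auto
  moreover have "{x. inner_dini \<mu> V \<alpha> t x < \<infinity>} \<subseteq> (\<Union>r. A r)"
    using reals_Archimedean2 by (auto simp: A_def)
  ultimately show ?thesis by (rule graph_coverable_subset[OF \<mu>])
qed

text \<open>
  The bounds on \<open>t\<close> place the thinner annulus inside the annulus with radii \<open>r/3\<close> and \<open>r\<close> of the conical defect,
  where \<open>r = 81 \<surd>n max(\<alpha>,1/\<alpha>) side Q\<close>.
\<close>

lemma inner_dini_le_conical_dini:
  fixes V :: "(real ^ 'n::finite) set"
  assumes \<mu>: "radon_measure \<mu>" and cone: "bad_cone V' \<alpha>' \<subseteq> bad_cone V \<alpha>"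
    and t: "27 * max \<alpha> (1 / \<alpha>) < real t" "2 * real t + 3 \<le> 81 * max \<alpha> (1 / \<alpha>)"
  shows "inner_dini \<mu> V' \<alpha>' t x \<le> conical_dini \<mu> V \<alpha> x"
  unfolding inner_dini_def conical_dini_eq_suminf
proof (intro suminf_le allI)
  fix k
  let ?j = "cell_index k x"
  let ?Q = "small_cube k ?j"
  have "inner_cone_region V' \<alpha>' t k ?j \<subseteq> cone_region V \<alpha> k ?j"
  proof
    fix y assume y: "y \<in> inner_cone_region V' \<alpha>' t k ?j"
    define s where "s = sqrt (real CARD('n)) / 2 ^ k"
    define M where "M = max \<alpha> (1 / \<alpha>)"
    have s: "s > 0" by (simp add: s_def)
    have r: "cone_radius ?Q \<alpha> = 81 * M * s"
      by (simp add: cone_radius_def cube_side_small_cube s_def M_def del: cube_side_dyadic_cube)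
    have "27 * M * s \<le> real t * s" "(2 * real t + 3) * s \<le> 81 * M * s"
      using t s by (auto simp: M_def intro!: mult_right_mono)
    moreover have "real t * s \<le> dist y (small_cube_center k ?j)"
        "dist y (small_cube_center k ?j) \<le> (2 * real t + 3) * s"
      using y by (auto simp: inner_cone_region_def s_def)
    ultimately have "cone_radius ?Q \<alpha> / 3 \<le> dist (cube_center ?Q) y" "dist (cube_center ?Q) y \<le> cone_radius ?Q \<alpha>"
      unfolding r cube_center_small_cube by (simp_all add: dist_commute)
    moreover have "y \<in> cone_at (bad_cone V \<alpha>) ?Q"
      using y cone by (auto simp: inner_cone_region_def cone_at_iff)
    ultimately have "y \<in> cone_annulus ?Q V \<alpha>"
      unfolding cone_annulus_def by auto
    then show "y \<in> cone_region V \<alpha> k ?j"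
      unfolding cone_region_def using small_cube_in_cone_cubes mem_own_cube by blast
  qed
  then have le: "\<mu> (inner_cone_region V' \<alpha>' t k ?j) \<le> \<mu> (cone_region V \<alpha> k ?j)"
    by (rule radon_mono[OF \<mu>])
  show "inner_defect \<mu> V' \<alpha>' t k ?j \<le> defect \<mu> ?Q V \<alpha>"
  proof (cases "\<mu> ?Q > 0")
    case True
    have fin: "\<mu> ?Q \<noteq> \<infinity>"
      using radon_bounded_finite[OF \<mu> bounded_small_cube[of k ?j]] by simp
    have "inner_defect \<mu> V' \<alpha>' t k ?j \<le> \<mu> (cone_region V \<alpha> k ?j) / \<mu> ?Q"
      using le True by (simp add: inner_defect_def divide_right_mono_ennreal)
    also have "\<dots> = defect \<mu> ?Q V \<alpha>"
      using True fin by (simp add: defect_mult[OF \<mu> True, symmetric] ennreal_mult_divide_eq zero_less_iff_neq_zero)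
    finally show ?thesis .
  qed (simp add: inner_defect_def)
qed auto

lemma finite_dini_graph_coverable:
  fixes \<mu> :: "(real ^ 'n::finite) set \<Rightarrow> ennreal"
  assumes \<mu>: "radon_measure \<mu>"
  shows "graph_coverable \<mu> m {x. \<exists>V\<in>grassmannian m. \<exists>\<alpha>>0. conical_dini \<mu> V \<alpha> x < \<infinity>}"
proof -
  obtain \<V> :: "(real ^ 'n) set set" where \<V>: "countable \<V>" "\<V> \<subseteq> grassmannian m"
    "\<And>V e. V \<in> grassmannian m \<Longrightarrow> e > 0 \<Longrightarrow>
      \<exists>V'\<in>\<V>. \<forall>x. norm (orth_proj V x - orth_proj V' x) \<le> e * norm x"
    by (rule countable_dense_grassmannian) blast
  define I where "I = \<V> \<times> (UNIV :: nat set) \<times> (UNIV :: nat set)"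
  define F where "F = (\<lambda>(V, a, t). {x. inner_dini \<mu> V (real a) t x < \<infinity>})"
  have "graph_coverable \<mu> m (\<Union>i\<in>I. F i)"
  proof (rule graph_coverable_UN[OF \<mu>])
    show "countable I" using \<V>(1) by (simp add: I_def)
    show "graph_coverable \<mu> m (F i)" if "i \<in> I" for i
    proof -
      obtain V a t where i: "i = (V, a, t)" "V \<in> grassmannian m"
        using \<open>i \<in> I\<close> \<V>(2) by (auto simp: I_def)
      then show ?thesis
        unfolding i F_def using inner_dini_graph_coverable[OF \<mu> i(2), of "real a" t] by simp
    qed
  qed
  moreover have "{x. \<exists>V\<in>grassmannian m. \<exists>\<alpha>>0. conical_dini \<mu> V \<alpha> x < \<infinity>} \<subseteq> (\<Union>i\<in>I. F i)"
  proof
    fix x assume "x \<in> {x. \<exists>V\<in>grassmannian m. \<exists>\<alpha>>0. conical_dini \<mu> V \<alpha> x < \<infinity>}"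
    then obtain V \<alpha> where V: "V \<in> grassmannian m" and \<alpha>: "\<alpha> > 0" and fin: "conical_dini \<mu> V \<alpha> x < \<infinity>"
      by auto
    obtain V' where V': "V' \<in> \<V>" "\<And>x. norm (orth_proj V x - orth_proj V' x) \<le> norm x / (4 * (1 + \<alpha>))"
      using \<V>(3)[OF V, of "1 / (4 * (1 + \<alpha>))"] \<alpha> by auto
    \<comment> \<open>A natural number serves as the new \<open>\<alpha>\<close>, so that countably many cones suffice.\<close>
    obtain a :: nat where a: "real a \<ge> max 1 (2 * \<alpha>)"
      using real_arch_simple by blast
    have cone: "bad_cone V' (real a) \<subseteq> bad_cone V \<alpha>"
      using V V' \<V>(2) \<alpha> a by (intro bad_cone_subset) (auto simp: grassmannian_def)
    define M where "M = max \<alpha> (1 / \<alpha>)"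
    have M: "M \<ge> 1"
      using \<alpha> by (cases "\<alpha> \<ge> 1") (auto simp: M_def le_max_iff_disj)
    \<comment> \<open>The least admissible \<open>t\<close>; as \<open>M \<ge> 1\<close>, the outer radius is proportional to \<open>2t + 3 \<le> 54M + 5\<close>, which is below \<open>81M\<close>.\<close>
    define t where "t = nat (\<lfloor>27 * M\<rfloor> + 1)"
    have t: "27 * M < real t" "real t \<le> 27 * M + 1"
      using M unfolding t_def by linarith+
    then have "2 * real t + 3 \<le> 81 * M" using M by linarith
    then have "inner_dini \<mu> V' (real a) t x \<le> conical_dini \<mu> V \<alpha> x"
      using t(1) by (intro inner_dini_le_conical_dini[OF \<mu> cone]) (simp_all add: M_def)
    then have "x \<in> F (V', a, t)" using fin by (simp add: F_def)
    moreover have "(V', a, t) \<in> I" using V'(1) by (simp add: I_def)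
    ultimately show "x \<in> (\<Union>i\<in>I. F i)" by blast
  qed
  ultimately show ?thesis by (rule graph_coverable_subset[OF \<mu>])
qed

section \<open>Almost every point of a graph has finite conical Dini function\<close>

text \<open>
  Recovers the generation of a cube, up to \<open>K\<close> choices, from a length that is comparable to its side.
\<close>

lemma dyadic_window:
  fixes a b g :: real
  assumes a: "0 < a" and K: "b / a < 2 ^ K"
  obtains k0 where "{k. a / 2 ^ k \<le> g \<and> g \<le> b / 2 ^ k} \<subseteq> {k0..<k0 + K}"
proof (cases "{k. a / 2 ^ k \<le> g \<and> g \<le> b / 2 ^ k} = {}")
  case True
  show ?thesis by (rule that[of 0]) (simp only: True empty_subsetI)
next
  case False
  define S where "S = {k. a / 2 ^ k \<le> g \<and> g \<le> b / 2 ^ k}"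
  define k0 where "k0 = (LEAST k. k \<in> S)"
  from False obtain k1 where "k1 \<in> S" unfolding S_def by blast
  then have k0: "k0 \<in> S" unfolding k0_def by (rule LeastI[where P = "\<lambda>k. k \<in> S"])
  have "k0 \<le> k \<and> k < k0 + K" if k: "k \<in> S" for k
  proof
    show "k0 \<le> k" unfolding k0_def by (rule Least_le[where P = "\<lambda>k. k \<in> S", OF k])
    show "k < k0 + K"
    proof (rule ccontr)
      assume "\<not> k < k0 + K"
      then have "(2::real) ^ (k0 + K) \<le> 2 ^ k" by (intro power_increasing) auto
      have "a / 2 ^ k0 \<le> b / 2 ^ k" using k k0 by (auto simp: S_def)
      then have "a * 2 ^ k \<le> b * 2 ^ k0" by (simp add: field_simps)
      moreover have "b < a * 2 ^ K" using K a by (simp add: field_simps)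
      then have "b * 2 ^ k0 < a * 2 ^ (k0 + K)" by (simp add: power_add field_simps)
      moreover have "a * 2 ^ (k0 + K) \<le> a * 2 ^ k"
        using a \<open>(2::real) ^ (k0 + K) \<le> 2 ^ k\<close> by (intro mult_left_mono) auto
      ultimately show False by linarith
    qed
  qed
  then have "S \<subseteq> {k0..<k0 + K}" by auto
  then show ?thesis unfolding S_def by (rule that)
qed

text \<open>
  Relative to the cube around \<open>y\<close>, the labels \<open>j\<close> range over a fixed finite box of integer vectors;
  hence \<open>N\<close> depends neither on \<open>k\<close> nor on \<open>y\<close>.
\<close>

lemma near_centers_count:
  fixes D :: real
  obtains N :: nat where
    "\<And>k (y :: real ^ 'n::finite). emeasure (count_space UNIV) {j. dist y (small_cube_center k j) \<le> D / 2 ^ k} \<le> of_nat N"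
proof -
  \<comment> \<open>The 2 absorbs the rounding in \<open>cell_index\<close> and the offset 1/2 of the centre.\<close>
  define n where "n = \<lceil>D\<rceil> + 2"
  define \<D> where "\<D> = PiE (UNIV :: 'n set) (\<lambda>_. {- n..n})"
  have fin: "finite \<D>" unfolding \<D>_def by (intro finite_PiE) auto
  have "emeasure (count_space UNIV) {j. dist y (small_cube_center k j) \<le> D / 2 ^ k} \<le> of_nat (card \<D>)"
    for k and y :: "real ^ 'n"
  proof -
    have sub: "{j. dist y (small_cube_center k j) \<le> D / 2 ^ k} \<subseteq> (\<lambda>d i. d i + cell_index k y i) ` \<D>"
    proof
      fix j :: "'n \<Rightarrow> int" assume "j \<in> {j. dist y (small_cube_center k j) \<le> D / 2 ^ k}"
      then have j: "dist y (small_cube_center k j) \<le> D / 2 ^ k" by simp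
      have "j i - cell_index k y i \<in> {- n..n}" for i
      proof -
        have "\<bar>y $ i - (of_int (j i) + 1/2) / 2 ^ k\<bar> \<le> D / 2 ^ k"
          using component_le_norm_cart[of "y - small_cube_center k j" i] j
          by (simp add: dist_norm small_cube_center_def)
        then have "\<bar>y $ i - (of_int (j i) + 1/2) / 2 ^ k\<bar> * 2 ^ k \<le> D"
          by (simp add: field_simps)
        also have "\<bar>y $ i - (of_int (j i) + 1/2) / 2 ^ k\<bar> * 2 ^ k = \<bar>(y $ i - (of_int (j i) + 1/2) / 2 ^ k) * 2 ^ k\<bar>"
          by (simp add: abs_mult)
        also have "(y $ i - (of_int (j i) + 1/2) / 2 ^ k) * 2 ^ k = y $ i * 2 ^ k - of_int (j i) - 1 / 2"
          by (simp add: field_simps)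
        finally have "\<bar>y $ i * 2 ^ k - of_int (j i) - 1 / 2\<bar> \<le> D" .
        then show ?thesis unfolding cell_index_def n_def atLeastAtMost_iff by linarith
      qed
      then have "(\<lambda>i. j i - cell_index k y i) \<in> \<D>"
        by (simp add: \<D>_def PiE_def)
      then show "j \<in> (\<lambda>d i. d i + cell_index k y i) ` \<D>"
        by (intro image_eqI[where x = "\<lambda>i. j i - cell_index k y i"]) simp_all
    qed
    then have finJ: "finite {j. dist y (small_cube_center k j) \<le> D / 2 ^ k}"
      using fin by (meson finite_imageI finite_subset)
    have "card {j. dist y (small_cube_center k j) \<le> D / 2 ^ k} \<le> card \<D>"
      using sub fin by (meson card_image_le card_mono finite_imageI le_trans)
    then show ?thesis
      using finJ by (simp add: emeasure_count_space_finite)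
  qed
  then show ?thesis by (rule that)
qed

text \<open>
  The quantity \<open>norm (y - \<pi> y - f (\<pi> y))\<close> is the vertical distance of \<open>y\<close> from the graph. It is
  comparable to the side of \<open>Q\<close>: a vector \<open>u\<close> of the cone of length at least about \<open>27 \<alpha> s\<close> has a normal part
  of more than \<open>\<alpha>\<close> times its tangential part, whereas the graph rises by at most \<open>L < \<alpha>/2\<close> times the tangential
  part. Here \<open>s\<close> bounds the diameter of a cube, and each replacement of a point by another
  one of the same cube is an error of at most \<open>s\<close>, which the factor 27 leaves room for.
\<close>

lemma graph_cone_estimates:
  fixes V :: "(real ^ 'n::finite) set" and L :: real
  defines "\<pi> \<equiv> orth_proj V" and "\<alpha> \<equiv> 2 * (L + 1)" and "n \<equiv> sqrt (real CARD('n))"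
  assumes V: "subspace V" and f: "L-lipschitz_on V f"
    and x0: "x0 \<in> small_cube k j" "x0 - \<pi> x0 = f (\<pi> x0)"
    and y: "y \<in> cone_region V \<alpha> k j"
  shows "dist y x0 \<le> 83 * \<alpha> * n / 2 ^ k"
    and "dist y (small_cube_center k j) \<le> 82 * \<alpha> * n / 2 ^ k"
    and "\<alpha> * n / 2 ^ k \<le> norm (y - \<pi> y - f (\<pi> y))"
    and "norm (y - \<pi> y - f (\<pi> y)) \<le> \<alpha> * (83 * \<alpha> * n) / 2 ^ k"
proof -
  let ?Q = "small_cube k j" and ?c = "small_cube_center k j"
  define s where "s = n / 2 ^ k"
  have s: "s > 0" by (simp add: s_def n_def)
  have L: "L \<ge> 0" by (rule lipschitz_on_nonneg[OF f])
  have \<alpha>: "\<alpha> \<ge> 2" using L by (simp add: \<alpha>_def)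
  note lin = linear_orth_proj[OF V]
  obtain i z where i: "y \<in> small_cube k i" "z \<in> small_cube k i" "z \<in> cone_annulus ?Q V \<alpha>"
  proof -
    obtain R where R: "R \<in> cone_cubes ?Q V \<alpha>" "y \<in> R" using y by (auto simp: cone_region_def)
    obtain i where "R = small_cube k i" using R(1) by (rule cone_cubes_small)
    then show ?thesis using R that by (auto simp: cone_cubes_def)
  qed
  have r: "cone_radius ?Q \<alpha> = 81 * (\<alpha> * s)"
  proof -
    have "1 / \<alpha> \<le> 1 / 2" using \<alpha> by (intro divide_left_mono) auto
    then have "max \<alpha> (1 / \<alpha>) = \<alpha>" using \<alpha> by (intro max.absorb1) linarith
    then show ?thesis
      by (simp add: cone_radius_def cube_side_small_cube s_def n_def mult.assoc del: cube_side_dyadic_cube)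
  qed
  have z: "dist ?c z \<le> 81 * (\<alpha> * s)" "27 * (\<alpha> * s) \<le> dist ?c z"
    using i(3) unfolding cone_annulus_def r cube_center_small_cube by auto
  obtain x where x: "x \<in> ?Q" "z - x \<in> bad_cone V \<alpha>"
  proof -
    have "z \<in> cone_at (bad_cone V \<alpha>) ?Q" using i(3) by (simp add: cone_annulus_def)
    then show ?thesis using that unfolding cone_at_iff by blast
  qed
  have dyz: "dist y z \<le> s" and dxc: "dist x ?c \<le> s" and dx0: "dist x x0 \<le> s" and dx0c: "dist x0 ?c \<le> s"
    using dist_in_cube_le[OF i(1,2)] dist_in_cube_le[OF x(1) center_in_cube]
      dist_in_cube_le[OF x(1) x0(1)] dist_in_cube_le[OF x0(1) center_in_cube]
    by (simp_all add: s_def n_def)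
  have s\<alpha>: "2 * s \<le> \<alpha> * s" using \<alpha> s by (intro mult_right_mono) auto
  have yc: "dist y ?c \<le> 81 * (\<alpha> * s) + s"
    using dist_triangle[of y ?c z] dyz z(1) by (simp add: dist_commute)
  then have "dist y ?c \<le> 82 * (\<alpha> * s)"
    using s\<alpha> s by linarith
  then show "dist y ?c \<le> 82 * \<alpha> * n / 2 ^ k"
    by (simp add: s_def mult.assoc)
  have w: "dist y x0 \<le> 81 * (\<alpha> * s) + 2 * s"
    using dist_triangle[of y x0 ?c] yc dx0c by (simp add: dist_commute)
  then have w': "dist y x0 \<le> 83 * (\<alpha> * s)"
    using s\<alpha> s by linarith
  then show "dist y x0 \<le> 83 * \<alpha> * n / 2 ^ k"
    by (simp add: s_def mult.assoc)
  define u where "u = z - x"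
  define a where "a = norm (u - \<pi> u)"
  define b where "b = norm (\<pi> u)"
  have ab: "\<alpha> * b < a" using x(2) by (simp add: bad_cone_eq[OF V] a_def b_def u_def \<pi>_def)
  have b0: "b \<ge> 0" by (simp add: b_def)
  have "norm u \<ge> 27 * (\<alpha> * s) - s"
    using z(2) dist_triangle[of z ?c x] dxc by (simp add: u_def dist_norm norm_minus_commute)
  then have ab2: "a + b \<ge> 27 * (\<alpha> * s) - s"
    using norm_le_orth_parts[of u V] by (simp add: a_def b_def \<pi>_def)
  have b2: "2 * b \<le> \<alpha> * b" using \<alpha> b0 by (intro mult_right_mono) auto
  define v where "v = y - x0"
  have split: "y - \<pi> y - f (\<pi> y) = (v - \<pi> v) - (f (\<pi> y) - f (\<pi> x0))"
    using x0(2) by (simp add: v_def linear_diff[OF lin] \<pi>_def algebra_simps)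
  have "dist (f (\<pi> y)) (f (\<pi> x0)) \<le> L * dist (\<pi> y) (\<pi> x0)"
    by (rule lipschitz_onD[OF f]) (simp_all add: \<pi>_def orth_proj_in[OF V])
  then have fv: "norm (f (\<pi> y) - f (\<pi> x0)) \<le> L * norm (\<pi> v)"
    by (simp add: dist_norm v_def \<pi>_def linear_diff[OF lin])
  have vu: "norm (v - u) \<le> 2 * s"
  proof -
    have "v - u = (y - z) + (x - x0)" by (simp add: v_def u_def)
    then show ?thesis
      using norm_triangle_ineq[of "y - z" "x - x0"] dyz dx0 by (simp add: dist_norm)
  qed
  have \<pi>vu: "norm (\<pi> v) \<le> b + 2 * s"
  proof -
    have "\<pi> v = \<pi> u + \<pi> (v - u)" by (simp add: \<pi>_def linear_diff[OF lin])
    then have "norm (\<pi> v) \<le> norm (\<pi> u) + norm (\<pi> (v - u))" using norm_triangle_ineq by metis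
    also have "norm (\<pi> (v - u)) \<le> 2 * s" 
      using norm_orth_proj_le[OF V, of "v - u"] vu by (simp add: \<pi>_def)
    finally show ?thesis by (simp add: b_def)
  qed
  have \<pi>'vu: "norm (v - \<pi> v) \<ge> a - 2 * s"
  proof -
    have "u - \<pi> u = (v - \<pi> v) - ((v - u) - \<pi> (v - u))"
      by (simp add: \<pi>_def linear_diff[OF lin])
    then have "norm (u - \<pi> u) \<le> norm (v - \<pi> v) + norm ((v - u) - \<pi> (v - u))"
      using norm_triangle_ineq4 by metis
    also have "norm ((v - u) - \<pi> (v - u)) \<le> 2 * s"
      using norm_orth_proj_compl_le[OF V, of "v - u"] vu by (simp add: \<pi>_def)
    finally show ?thesis by (simp add: a_def)
  qed
  show "\<alpha> * n / 2 ^ k \<le> norm (y - \<pi> y - f (\<pi> y))"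
  proof -
    have "norm (v - \<pi> v) \<le> norm (y - \<pi> y - f (\<pi> y)) + norm (f (\<pi> y) - f (\<pi> x0))"
      unfolding split
      using norm_triangle_ineq[of "(v - \<pi> v) - (f (\<pi> y) - f (\<pi> x0))" "f (\<pi> y) - f (\<pi> x0)"] by simp
    moreover have "L * norm (\<pi> v) \<le> L * (b + 2 * s)"
      by (intro mult_left_mono \<pi>vu L)
    \<comment> \<open>The choice of \<open>\<alpha>\<close> is used here: half of the normal part \<open>a\<close> survives the rise of the graph.\<close>
    moreover have "2 * (L * (b + 2 * s)) = \<alpha> * b + 2 * (\<alpha> * s) - 2 * b - 4 * s"
      by (simp add: \<alpha>_def algebra_simps)
    ultimately have "\<alpha> * s \<le> norm (y - \<pi> y - f (\<pi> y))"
      using fv \<pi>'vu ab ab2 b2 s\<alpha> s b0 by linarith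
    then show ?thesis by (simp add: s_def)
  qed
  show "norm (y - \<pi> y - f (\<pi> y)) \<le> \<alpha> * (83 * \<alpha> * n) / 2 ^ k"
  proof -
    have "norm (y - \<pi> y - f (\<pi> y)) \<le> norm (v - \<pi> v) + L * norm (\<pi> v)"
      unfolding split using norm_triangle_ineq4 fv by (rule order_trans[OF _ add_left_mono])
    also have "\<dots> \<le> norm v + L * norm v"
      using norm_orth_proj_compl_le[OF V] norm_orth_proj_le[OF V] L
      by (auto simp: \<pi>_def intro!: add_mono mult_left_mono)
    also have "\<dots> \<le> \<alpha> * norm v"
      using L mult_right_mono[of "1 + L" \<alpha> "norm v"] by (simp add: \<alpha>_def distrib_right)
    also have "\<dots> \<le> \<alpha> * (83 * (\<alpha> * s))"
      using w' \<alpha> by (intro mult_left_mono) (auto simp: v_def dist_norm)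
    finally show ?thesis by (simp add: s_def mult.assoc)
  qed
qed

text \<open>
  A point \<open>y\<close> in the conical region of a cube that meets the graph determines the generation of the
  cube up to \<open>K\<close> choices, by its vertical distance from the graph, and then the cube itself up
  to \<open>N\<close> choices, by its distance from the centre. So \<open>K * N\<close> bounds the overlap.
\<close>

lemma graph_finite_dini_AE:
  fixes \<Gamma> :: "(real ^ 'n::finite) set"
  assumes \<mu>: "radon_measure \<mu>" and \<Gamma>: "\<Gamma> \<in> lipschitz_graphs m"
  obtains V \<alpha> where "V \<in> grassmannian m" "\<alpha> > 0" "\<mu> (\<Gamma> - {x. conical_dini \<mu> V \<alpha> x < \<infinity>}) = 0"
proof -
  obtain V f L where V: "V \<in> grassmannian m" and f: "L-lipschitz_on V f"
    and \<Gamma>_eq: "\<Gamma> = {y. y - orth_proj V y = f (orth_proj V y)}"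
    using \<Gamma> by (rule lipschitz_graph_cases)
  have sub: "subspace V" using V by (simp add: grassmannian_def)
  define \<alpha> where "\<alpha> = 2 * (L + 1)"
  define s where "s = sqrt (real CARD('n))"
  have s: "s > 0" by (simp add: s_def)
  have \<alpha>: "\<alpha> > 0" using lipschitz_on_nonneg[OF f] by (simp add: \<alpha>_def)
  let ?W = "cone_region V \<alpha>"
  let ?Q = "\<lambda>k j. small_cube k j :: (real ^ 'n) set"
  define g where "g y = norm (y - orth_proj V y - f (orth_proj V y))" for y
  obtain N :: nat where N: "\<And>k (y :: real ^ 'n). emeasure (count_space UNIV)
      {j. dist y (small_cube_center k j) \<le> (82 * \<alpha> * s) / 2 ^ k} \<le> of_nat N"
    by (rule near_centers_count[of "82 * \<alpha> * s"]) (rule that)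
  obtain K :: nat where K: "(\<alpha> * (83 * \<alpha> * s)) / (\<alpha> * s) < 2 ^ K"
    using real_arch_pow[of 2] by auto
  have null: "\<mu> (\<Gamma> \<inter> ball 0 (real \<rho>) - {x. conical_dini \<mu> V \<alpha> x < \<infinity>}) = 0" for \<rho> :: nat
  proof -
    \<comment> \<open>A ball that contains the conical regions of all cubes meeting \<open>\<Gamma>\<close> in the ball of radius \<open>\<rho>\<close>.\<close>
    define r where "r = real \<rho> + 83 * \<alpha> * s + s"
    define A where "A = \<Gamma> \<inter> ball 0 (real \<rho>)"
    let ?M = "ball_restriction \<mu> r"
    have cell: "{x \<in> space ?M. cell_index k x = j} = ?Q k j" for k j
      by (auto simp: mem_dyadic_cube_iff)
    have A: "A \<in> sets ?M"
      using closed_lipschitz_graph[OF \<Gamma>] by (simp add: A_def borel_closed)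
    have scale: "c / 2 ^ k \<le> c" if "c \<ge> 0" for c :: real and k :: nat
      using divide_left_mono[of 1 "2 ^ k" c] that by simp
    have "AE x in ?M. x \<in> A \<longrightarrow> (\<Sum>k. defect \<mu> (?Q k (cell_index k x)) V \<alpha>) < \<infinity>"
    proof (rule suminf_finite_AE[where W = ?W and C = "of_nat K * of_nat N"])
      fix k j assume "A \<inter> {x \<in> space ?M. cell_index k x = j} \<noteq> {}"
      then obtain x0 where x0: "x0 \<in> A" "x0 \<in> ?Q k j" unfolding cell by auto
      have "?W k j \<subseteq> ball 0 r"
      proof
        fix y assume y: "y \<in> ?W k j"
        have "dist y x0 \<le> 83 * \<alpha> * s / 2 ^ k"
          unfolding \<alpha>_def s_def
          by (rule graph_cone_estimates(1)[OF sub f x0(2)]) (use x0 y in \<open>auto simp: A_def \<Gamma>_eq \<alpha>_def\<close>)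
        also have "\<dots> \<le> 83 * \<alpha> * s" using \<alpha> s by (intro scale) simp
        finally show "y \<in> ball 0 r"
          using x0(1) s dist_triangle[of 0 y x0] by (auto simp: A_def r_def dist_commute)
      qed
      then have "emeasure ?M (?W k j) = \<mu> (?W k j)"
        by (simp add: emeasure_ball_restriction[OF \<mu>] Int_absorb1)
      moreover have "defect \<mu> (?Q k j) V \<alpha> * emeasure ?M (?Q k j) \<le> \<mu> (?W k j)"
      proof (cases "\<mu> (?Q k j) > 0")
        case True
        have "emeasure ?M (?Q k j) \<le> \<mu> (?Q k j)"
          by (simp add: emeasure_ball_restriction[OF \<mu>] radon_mono[OF \<mu>])
        then show ?thesis
          unfolding defect_mult[OF \<mu> True, symmetric] by (intro mult_left_mono) auto
      qed (simp add: defect_def)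
      ultimately show "defect \<mu> (?Q k j) V \<alpha> * emeasure ?M {x \<in> space ?M. cell_index k x = j} \<le> emeasure ?M (?W k j)"
        unfolding cell by simp
    next
      fix y
      let ?J = "\<lambda>k. {j. A \<inter> {x \<in> space ?M. cell_index k x = j} \<noteq> {} \<and> y \<in> ?W k j}"
      have J: "dist y (small_cube_center k j) \<le> (82 * \<alpha> * s) / 2 ^ k \<and>
          \<alpha> * s / 2 ^ k \<le> g y \<and> g y \<le> \<alpha> * (83 * \<alpha> * s) / 2 ^ k" if j: "j \<in> ?J k" for j k
      proof -
        obtain x0 where x0: "x0 \<in> ?Q k j" "x0 - orth_proj V x0 = f (orth_proj V x0)"
          using j unfolding cell by (auto simp: A_def \<Gamma>_eq)
        have y: "y \<in> cone_region V (2 * (L + 1)) k j" using j by (simp add: \<alpha>_def)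
        show ?thesis
          using graph_cone_estimates(2-4)[OF sub f x0 y] by (simp add: \<alpha>_def s_def g_def)
      qed
      obtain k0 where k0: "{k. \<alpha> * s / 2 ^ k \<le> g y \<and> g y \<le> \<alpha> * (83 * \<alpha> * s) / 2 ^ k} \<subseteq> {k0..<k0 + K}"
        using dyadic_window[OF _ K, of "g y"] \<alpha> s by (metis mult_pos_pos)
      have "(\<Sum>k. emeasure (count_space UNIV) (?J k)) = (\<Sum>k\<in>{k0..<k0 + K}. emeasure (count_space UNIV) (?J k))"
      proof (rule suminf_finite)
        fix k assume "k \<notin> {k0..<k0 + K}"
        then have "?J k = {}" using k0 J[of _ k] by blast
        then show "emeasure (count_space UNIV) (?J k) = 0" by (simp only: emeasure_empty)
      qed simp
      also have "\<dots> \<le> (\<Sum>k\<in>{k0..<k0 + K}. of_nat N)"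
      proof (rule sum_mono)
        fix k
        have "emeasure (count_space UNIV) (?J k) \<le> emeasure (count_space UNIV)
            {j. dist y (small_cube_center k j) \<le> (82 * \<alpha> * s) / 2 ^ k}"
          using J by (intro emeasure_mono) auto
        also have "\<dots> \<le> of_nat N" by (rule N)
        finally show "emeasure (count_space UNIV) (?J k) \<le> of_nat N" .
      qed
      finally show "(\<Sum>k. emeasure (count_space UNIV) (?J k)) \<le> of_nat K * of_nat N" by simp
    next
      show "of_nat K * of_nat N < (\<infinity> :: ennreal)"
        using of_nat_less_top[of "K * N"] by simp
    qed (use A finite_measure_ball_restriction[OF \<mu>] in auto)
    then have ae: "AE x in ?M. x \<in> A \<longrightarrow> conical_dini \<mu> V \<alpha> x < \<infinity>"
      by (simp add: conical_dini_eq_suminf)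
    have "conical_dini \<mu> V \<alpha> \<in> borel_measurable borel"
      unfolding conical_dini_eq_suminf[abs_def]
      by (intro borel_measurable_suminf_order measurable_compose[OF measurable_cell_index]) simp
    then have B: "A - {x. conical_dini \<mu> V \<alpha> x < \<infinity>} \<in> sets borel"
      using A by (intro sets.Diff) auto
    have "emeasure ?M {x \<in> space ?M. \<not> (x \<in> A \<longrightarrow> conical_dini \<mu> V \<alpha> x < \<infinity>)} = 0"
    proof (rule AE_iff_measurable[THEN iffD1, OF _ refl ae])
      have "{x \<in> space ?M. \<not> (x \<in> A \<longrightarrow> conical_dini \<mu> V \<alpha> x < \<infinity>)} = A - {x. conical_dini \<mu> V \<alpha> x < \<infinity>}" by auto
      then show "{x \<in> space ?M. \<not> (x \<in> A \<longrightarrow> conical_dini \<mu> V \<alpha> x < \<infinity>)} \<in> sets ?M" using B by simp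
    qed
    moreover have "{x \<in> space ?M. \<not> (x \<in> A \<longrightarrow> conical_dini \<mu> V \<alpha> x < \<infinity>)} = A - {x. conical_dini \<mu> V \<alpha> x < \<infinity>}" by auto
    ultimately have "\<mu> (ball 0 r \<inter> (A - {x. conical_dini \<mu> V \<alpha> x < \<infinity>})) = 0"
      using emeasure_ball_restriction[OF \<mu> B] by simp
    moreover have "ball 0 r \<inter> (A - {x. conical_dini \<mu> V \<alpha> x < \<infinity>}) = A - {x. conical_dini \<mu> V \<alpha> x < \<infinity>}"
    proof -
      have "83 * \<alpha> * s > 0" using \<alpha> s by simp
      then show ?thesis using s unfolding A_def r_def by auto
    qed
    ultimately show ?thesis by (simp add: A_def)
  qed
  have "\<Gamma> - {x. conical_dini \<mu> V \<alpha> x < \<infinity>} \<subseteq> (\<Union>\<rho>. \<Gamma> \<inter> ball 0 (real \<rho>) - {x. conical_dini \<mu> V \<alpha> x < \<infinity>})"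
    using reals_Archimedean2 by auto
  then have "\<mu> (\<Gamma> - {x. conical_dini \<mu> V \<alpha> x < \<infinity>}) = 0"
    by (rule radon_null_mono[OF \<mu> _ radon_null_UN[OF \<mu> null]])
  with V \<alpha> show ?thesis by (rule that)
qed

section \<open>The decomposition\<close>

lemma borel_UN_lipschitz_graphs:
  assumes "countable \<G>" "\<G> \<subseteq> lipschitz_graphs m"
  shows "\<Union>\<G> \<in> sets borel"
  using assms closed_lipschitz_graph by (intro sets.countable_Union) (auto intro!: borel_closed)

text \<open>
  A decomposition is determined by the graphs \<open>\<G>\<close> that carry its first part: the second part
  vanishes on their union, the first part off it.
\<close>

lemma lipschitz_graph_decomposition_restrict:
  assumes d: "lipschitz_graph_decomposition m \<mu> \<nu> \<sigma>"
  obtains \<G> where "countable \<G>" "\<G> \<subseteq> lipschitz_graphs m"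
    "\<nu> = restrict_outer \<mu> (\<Union>\<G>)" "\<sigma> = restrict_outer \<mu> (- \<Union>\<G>)"
proof -
  have sum: "\<And>A. \<mu> A = \<nu> A + \<sigma> A" and \<nu>: "radon_measure \<nu>" "carried_by \<nu> (lipschitz_graphs m)"
    and \<sigma>: "radon_measure \<sigma>" "singular_to \<sigma> (lipschitz_graphs m)"
    using d by (auto simp: lipschitz_graph_decomposition_def)
  obtain G :: "nat \<Rightarrow> 'a set" where G: "\<And>i. G i \<in> lipschitz_graphs m" "\<nu> (UNIV - (\<Union>i. G i)) = 0"
    using \<nu>(2) by (auto simp: carried_by_def)
  define F where "F = \<Union>(range G)"
  have sub: "range G \<subseteq> lipschitz_graphs m" using G(1) by auto
  have F: "F \<in> sets borel"
    unfolding F_def by (rule borel_UN_lipschitz_graphs[OF _ sub]) simp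
  have \<sigma>F: "\<sigma> F = 0"
    unfolding F_def using G(1) \<sigma>(2) by (intro radon_null_UN[OF \<sigma>(1)]) (auto simp: singular_to_def)
  have \<nu>F: "\<nu> (- F) = 0" using G(2) by (simp add: F_def Compl_eq_Diff_UNIV)
  have "\<nu> A = \<mu> (F \<inter> A)" for A
  proof -
    have "\<nu> (A - F) = 0" by (rule radon_null_mono[OF \<nu>(1) _ \<nu>F]) auto
    moreover have "\<sigma> (F \<inter> A) = 0" by (rule radon_null_mono[OF \<sigma>(1) _ \<sigma>F]) auto
    ultimately show ?thesis
      using radon_split[OF \<nu>(1) F, of A] sum[of "F \<inter> A"] by (simp add: Int_commute)
  qed
  moreover have "\<sigma> A = \<mu> (- F \<inter> A)" for A
  proof -
    have "\<sigma> (A \<inter> F) = 0" by (rule radon_null_mono[OF \<sigma>(1) _ \<sigma>F]) auto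
    moreover have "\<nu> (A - F) = 0" by (rule radon_null_mono[OF \<nu>(1) _ \<nu>F]) auto
    moreover have "- F \<inter> A = A - F" by auto
    ultimately show ?thesis
      using radon_split[OF \<sigma>(1) F, of A] sum[of "A - F"] by simp
  qed
  ultimately have "\<nu> = restrict_outer \<mu> F" "\<sigma> = restrict_outer \<mu> (- F)"
    by (simp_all add: fun_eq_iff restrict_outer_def)
  then show ?thesis
    using sub by (intro that[of "range G"]) (simp_all add: F_def)
qed

text \<open>
  The unions of graphs that carry two decompositions differ by a null set, since the singular part of
  each vanishes on the graphs of the other.
\<close>

lemma lipschitz_graph_decomposition_unique:
  assumes \<mu>: "radon_measure \<mu>"
    and d1: "lipschitz_graph_decomposition m \<mu> \<nu>1 \<sigma>1" and d2: "lipschitz_graph_decomposition m \<mu> \<nu>2 \<sigma>2"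
  shows "\<nu>1 = \<nu>2 \<and> \<sigma>1 = \<sigma>2"
proof -
  have null: "\<mu> (\<Union>\<G> - F) = 0"
    if d: "lipschitz_graph_decomposition m \<mu> \<nu> \<sigma>" and \<sigma>_eq: "\<sigma> = restrict_outer \<mu> (- F)"
      and \<G>: "countable \<G>" "\<G> \<subseteq> lipschitz_graphs m" for \<nu> \<sigma> F \<G>
  proof -
    have "singular_to \<sigma> (lipschitz_graphs m)"
      using d unfolding lipschitz_graph_decomposition_def by blast
    then have "\<mu> (\<Gamma> - F) = 0" if "\<Gamma> \<in> \<G>" for \<Gamma>
      using that \<G>(2) by (auto simp: singular_to_def \<sigma>_eq restrict_outer_def Diff_eq Int_commute)
    then have "\<mu> (\<Union>\<Gamma>\<in>\<G>. \<Gamma> - F) = 0" by (rule radon_null_UN_countable[OF \<mu> \<G>(1)])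
    then show ?thesis by (rule radon_null_mono[OF \<mu>, rotated]) auto
  qed
  obtain \<G>1 where 1: "countable \<G>1" "\<G>1 \<subseteq> lipschitz_graphs m"
      "\<nu>1 = restrict_outer \<mu> (\<Union>\<G>1)" "\<sigma>1 = restrict_outer \<mu> (- \<Union>\<G>1)"
    by (rule lipschitz_graph_decomposition_restrict[OF d1])
  obtain \<G>2 where 2: "countable \<G>2" "\<G>2 \<subseteq> lipschitz_graphs m"
      "\<nu>2 = restrict_outer \<mu> (\<Union>\<G>2)" "\<sigma>2 = restrict_outer \<mu> (- \<Union>\<G>2)"
    by (rule lipschitz_graph_decomposition_restrict[OF d2])
  have 12: "\<mu> (\<Union>\<G>1 - \<Union>\<G>2) = 0" by (rule null[OF d2 2(4) 1(1,2)])
  have 21: "\<mu> (\<Union>\<G>2 - \<Union>\<G>1) = 0" by (rule null[OF d1 1(4) 2(1,2)])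
  have "\<nu>1 = \<nu>2"
    unfolding 1 2 by (rule restrict_outer_eq_mod_null[OF \<mu> 12 21])
  moreover have "- \<Union>\<G>1 - - \<Union>\<G>2 = \<Union>\<G>2 - \<Union>\<G>1" "- \<Union>\<G>2 - - \<Union>\<G>1 = \<Union>\<G>1 - \<Union>\<G>2" by auto
  then have "\<sigma>1 = \<sigma>2"
    unfolding 1 2 using 12 21 by (intro restrict_outer_eq_mod_null[OF \<mu>]) simp_all
  ultimately show ?thesis ..
qed

lemma graph_minus_finite_dini_null:
  fixes \<Gamma> :: "(real ^ 'n::finite) set"
  assumes \<mu>: "radon_measure \<mu>" and \<Gamma>: "\<Gamma> \<in> lipschitz_graphs m"
  shows "\<mu> (\<Gamma> - {x. \<exists>V\<in>grassmannian m. \<exists>\<alpha>>0. conical_dini \<mu> V \<alpha> x < \<infinity>}) = 0"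
proof -
  obtain V \<alpha> where V: "V \<in> grassmannian m" "\<alpha> > 0" and null: "\<mu> (\<Gamma> - {x. conical_dini \<mu> V \<alpha> x < \<infinity>}) = 0"
    by (rule graph_finite_dini_AE[OF \<mu> \<Gamma>])
  show ?thesis
    by (rule radon_null_mono[OF \<mu> _ null]) (use V in blast)
qed

theorem theorem1p5:
  fixes \<mu> :: "(real ^ 'n::finite) set \<Rightarrow> ennreal" and m :: nat
  assumes "1 \<le> m" and "m \<le> CARD('n) - 1"
    and "radon_measure \<mu>"
  shows "\<exists>\<mu>G \<mu>P.
    lipschitz_graph_decomposition m \<mu> \<mu>G \<mu>P \<and>
    (\<forall>\<nu> \<sigma>. lipschitz_graph_decomposition m \<mu> \<nu> \<sigma> \<longrightarrow> \<nu> = \<mu>G \<and> \<sigma> = \<mu>P) \<and>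
    \<mu>G = restrict_outer \<mu>
      {x. \<exists>V \<in> grassmannian m. \<exists>\<alpha>>0. conical_dini \<mu> V \<alpha> x < \<infinity>} \<and>
    \<mu>P = restrict_outer \<mu>
      {x. \<forall>V \<in> grassmannian m. \<forall>\<alpha>>0. conical_dini \<mu> V \<alpha> x = \<infinity>}"
proof -
  note \<mu> = assms(3)
  define E where "E = {x. \<exists>V \<in> grassmannian m. \<exists>\<alpha>>0. conical_dini \<mu> V \<alpha> x < \<infinity>}"
  have E_compl: "{x. \<forall>V \<in> grassmannian m. \<forall>\<alpha>>0. conical_dini \<mu> V \<alpha> x = \<infinity>} = - E"
    by (auto simp: E_def simp flip: less_top)
  have "m \<le> DIM(real ^ 'n)" using assms(2) by simp
  then obtain \<Gamma>0 :: "(real ^ 'n) set" where \<Gamma>0: "\<Gamma>0 \<in> lipschitz_graphs m"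
    by (rule lipschitz_graphs_nonempty)
  obtain \<G>' where \<G>': "countable \<G>'" "\<G>' \<subseteq> lipschitz_graphs m" "\<mu> (E - \<Union>\<G>') = 0"
    using finite_dini_graph_coverable[OF \<mu>, of m] unfolding graph_coverable_def E_def by blast
  \<comment> \<open>A graph is added because \<open>carried_by\<close> asks for a sequence, which an empty family cannot supply.\<close>
  define \<G> where "\<G> = insert \<Gamma>0 \<G>'"
  define S where "S = \<Union>\<G>"
  have \<G>: "countable \<G>" "\<G> \<subseteq> lipschitz_graphs m" "\<G> \<noteq> {}"
    using \<G>' \<Gamma>0 by (auto simp: \<G>_def)
  have S: "S \<in> sets borel" unfolding S_def by (rule borel_UN_lipschitz_graphs[OF \<G>(1,2)])
  have E_S: "\<mu> (E - S) = 0"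
    by (rule radon_null_mono[OF \<mu> _ \<G>'(3)]) (auto simp: S_def \<G>_def)
  have graph_null: "\<mu> (\<Gamma> - E) = 0" if "\<Gamma> \<in> lipschitz_graphs m" for \<Gamma>
    using graph_minus_finite_dini_null[OF \<mu> that] by (simp add: E_def)
  have "\<mu> (\<Union>\<Gamma>\<in>\<G>. \<Gamma> - E) = 0"
    using \<G>(2) graph_null by (intro radon_null_UN_countable[OF \<mu> \<G>(1)]) auto
  then have S_E: "\<mu> (S - E) = 0"
    by (rule radon_null_mono[OF \<mu>, rotated]) (auto simp: S_def)
  define \<mu>G where "\<mu>G = restrict_outer \<mu> E"
  define \<mu>P where "\<mu>P = restrict_outer \<mu> (- E)"
  have \<mu>G: "\<mu>G = restrict_outer \<mu> S"
    unfolding \<mu>G_def by (rule restrict_outer_eq_mod_null[OF \<mu> E_S S_E])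
  have "- E - - S = S - E" "- S - - E = E - S" by auto
  then have \<mu>P: "\<mu>P = restrict_outer \<mu> (- S)"
    unfolding \<mu>P_def using E_S S_E by (intro restrict_outer_eq_mod_null[OF \<mu>]) simp_all
  have dec: "lipschitz_graph_decomposition m \<mu> \<mu>G \<mu>P"
    unfolding lipschitz_graph_decomposition_def
  proof (intro conjI allI)
    show "\<mu> A = \<mu>G A + \<mu>P A" for A
      using radon_split[OF \<mu> S, of A] by (simp add: \<mu>G \<mu>P restrict_outer_def Diff_eq Int_commute)
    show "radon_measure \<mu>G" "radon_measure \<mu>P"
      unfolding \<mu>G \<mu>P using S by (auto intro: radon_restrict_outer[OF \<mu>])
    have "range (from_nat_into \<G>) = \<G>"
      by (rule range_from_nat_into[OF \<G>(3,1)])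
    then have "\<mu>G (UNIV - (\<Union>i. from_nat_into \<G> i)) = 0"
      using E_S by (simp add: \<mu>G_def restrict_outer_def S_def Diff_eq)
    then show "carried_by \<mu>G (lipschitz_graphs m)"
      unfolding carried_by_def using from_nat_into[OF \<G>(3)] \<G>(2) by blast
    show "singular_to \<mu>P (lipschitz_graphs m)"
      using graph_null by (auto simp: singular_to_def \<mu>P_def restrict_outer_def Diff_eq Int_commute)
  qed
  have uniq: "\<forall>\<nu> \<sigma>. lipschitz_graph_decomposition m \<mu> \<nu> \<sigma> \<longrightarrow> \<nu> = \<mu>G \<and> \<sigma> = \<mu>P"
    using lipschitz_graph_decomposition_unique[OF \<mu> _ dec] by blast
  show ?thesis
    unfolding E_compl unfolding E_def[symmetric]
    by (intro exI[of _ \<mu>G] exI[of _ \<mu>P] conjI dec uniq \<mu>G_def \<mu>P_def)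
qed

end
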